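(* Let $T$ be a $d$-regular rooted tree, let $\mathcal{A}$ be a finite invertible automaton over an alphabet of $d$ letters and $G(\mathcal{A})\le\mathrm{Aut}(T)$ the group generated by $\mathcal{A}$. Let $p$ be a prime and let $\mathcal{P}\le\mathrm{Aut}(T^D)$ be a minimal pattern subgroup of depth $D$ that is a $p$-group and whose associated group of finite type $G_{\mathcal{P}}$ is topologically finitely generated. If $\pi_D(G(\mathcal{A}))=\mathcal{P}$ (that is, the action of $G(\mathcal{A})$ on the first $D$ levels coincides with that of $\mathcal{P}$), then $G_{\mathcal{P}}$ is the closure of $G(\mathcal{A})$ in $\mathrm{Aut}(T)$.
   Context: $T$ is the $d$-regular rooted tree ($d\ge2$) with vertices the finite words over $X=\{1,\dots,d\}$, $T^n$ its truncation to levels $0,\dots,n$. $\mathrm{Aut}(T)$ is the group of root- and adjacency-preserving bijections of $T$, a profinite group with the pointwise stabilizers of the levels as a base of neighborhoods of the identity; $\pi_n:\mathrm{Aut}(T)\to\mathrm{Aut}(T^n)$ is restriction. For $g\in\mathrm{Aut}(T)$ and a vertex $v$, the section $g|_v\in \mathrm{Aut}(T)$ is defined by $g(vw)=g(v)\,g|_v(w)$, and $g|_v^n:=\pi_n(g|_v)$. For $\mathcal{P}\le\mathrm{Aut}(T^D)$, the associated group of finite type is $G_{\mathcal{P}}=\{g\in\mathrm{Aut}(T): g|_v^D\in\mathcal{P}\text{ for all vertices }v\}$; $\mathcal{P}$ is a minimal pattern subgroup if $\pi_D(G_{\mathcal{P}})=\mathcal{P}$. An automaton is a tuple $\mathcal{A}=(Q,X,\tau)$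 with state set $Q$, alphabet $X$ and transition function $\tau:Q\times X\to X\times Q$; it is finite if $Q$ is finite and invertible if for each $q\in Q$ the first component of $\tau(q,\cdot)$ is a permutation of $X$. Each state $q$ of an invertible automaton defines $g_q\in\mathrm{Aut}(T)$ by $g_q(xw)=y\,g_{q'}(w)$ where $\tau(q,x)=(y,q')$, and $G(\mathcal{A})=\langle g_q: q\in Q\rangle$. A topological group is topologically finitely generated if it has a dense finitely generated subgroup. *)

theory Defs
  imports
    "HOL-Algebra.Bij"
    "HOL-Algebra.Generated_Groups"
    "HOL-Analysis.Abstract_Topology"
    "HOL-Computational_Algebra.Primes"
    "HOL-Library.Cardinality"
begin

text \<open>
  The alphabet is a finite type \<open>'x\<close> with \<open>d = CARD('x)\<close> letters. The vertices of the
  \<open>d\<close>-regular rooted tree are all words of type \<open>'x list\<close>; the root is the empty word and the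
  children of \<open>v\<close> are the words \<open>v @ [x]\<close>.
\<close>

definition tree_adj :: "'x list \<Rightarrow> 'x list \<Rightarrow> bool" where
  "tree_adj u v \<longleftrightarrow> (\<exists>x. v = u @ [x] \<or> u = v @ [x])"

definition trunc_tree :: "nat \<Rightarrow> 'x list set" where
  "trunc_tree n = {v. length v \<le> n}"

text \<open>
  Automorphism group of the subtree with vertex set \<open>V\<close>, as a subgroup of the library's group
  of bijections of \<open>V\<close>; its elements are extensional, i.e. undefined outside \<open>V\<close>.
\<close>

definition tree_auts :: "'x list set \<Rightarrow> ('x list \<Rightarrow> 'x list) set" where
  "tree_auts V =
     {g \<in> Bij V. g [] = [] \<and> (\<forall>u\<in>V. \<forall>v\<in>V. tree_adj (g u) (g v) \<longleftrightarrow> tree_adj u v)}"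

definition Aut_tree :: "'x list set \<Rightarrow> ('x list \<Rightarrow> 'x list) monoid" where
  "Aut_tree V = (BijGroup V)\<lparr>carrier := tree_auts V\<rparr>"

abbreviation Aut_T :: "('x list \<Rightarrow> 'x list) monoid" where
  "Aut_T \<equiv> Aut_tree UNIV"

abbreviation Aut_T_trunc :: "nat \<Rightarrow> ('x list \<Rightarrow> 'x list) monoid" where
  "Aut_T_trunc n \<equiv> Aut_tree (trunc_tree n)"

definition tree_proj :: "nat \<Rightarrow> ('x list \<Rightarrow> 'x list) \<Rightarrow> ('x list \<Rightarrow> 'x list)" where
  "tree_proj n g = restrict g (trunc_tree n)"

text \<open>
  The section of \<open>g\<close> at \<open>v\<close>. For a tree automorphism \<open>g\<close> it is the map determined by
  \<open>g (v @ w) = g v @ tree_section g v w\<close>; see \<open>section_eq\<close> below.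
\<close>

definition tree_section :: "('x list \<Rightarrow> 'x list) \<Rightarrow> 'x list \<Rightarrow> ('x list \<Rightarrow> 'x list)" where
  "tree_section g v = (\<lambda>w. drop (length v) (g (v @ w)))"

definition finite_type_group ::
  "nat \<Rightarrow> ('x list \<Rightarrow> 'x list) set \<Rightarrow> ('x list \<Rightarrow> 'x list) set" where
  "finite_type_group D P =
     {g \<in> carrier Aut_T. \<forall>v. tree_proj D (tree_section g v) \<in> P}"

definition minimal_pattern_subgroup :: "nat \<Rightarrow> ('x list \<Rightarrow> 'x list) set \<Rightarrow> bool" where
  "minimal_pattern_subgroup D P \<longleftrightarrow>
     subgroup P (Aut_T_trunc D) \<and> tree_proj D ` finite_type_group D P = P"

definition level_stab :: "nat \<Rightarrow> ('x list \<Rightarrow> 'x list) set" where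
  "level_stab n = {g \<in> carrier Aut_T. \<forall>v. length v = n \<longrightarrow> g v = v}"

text \<open>
  The group topology with the level stabilizers as a base of neighbourhoods of the identity:
  a set is open iff with each of its points it contains a coset of some level stabilizer.
\<close>

definition Aut_T_topology :: "('x list \<Rightarrow> 'x list) topology" where
  "Aut_T_topology =
     topology (\<lambda>U. U \<subseteq> carrier Aut_T \<and> (\<forall>g\<in>U. \<exists>n. g <#\<^bsub>Aut_T\<^esub> level_stab n \<subseteq> U))"

definition topologically_fin_gen :: "('g, 'm) monoid_scheme \<Rightarrow> 'g topology \<Rightarrow> bool" where
  "topologically_fin_gen G X \<longleftrightarrow>
     (\<exists>S. finite S \<and> S \<subseteq> carrier G \<and> X closure_of (generate G S) = carrier G)"

text \<open>
  The pair \<open>trans A (q, x)\<close> consists of the output letter and the next state; only its values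
  for \<open>q \<in> states A\<close> are relevant.
\<close>

record ('q, 'x) automaton =
  states :: "'q set"
  trans :: "'q \<times> 'x \<Rightarrow> 'x \<times> 'q"

definition is_automaton :: "('q, 'x) automaton \<Rightarrow> bool" where
  "is_automaton A \<longleftrightarrow> (\<forall>q\<in>states A. \<forall>x. snd (trans A (q, x)) \<in> states A)"

definition finite_automaton :: "('q, 'x) automaton \<Rightarrow> bool" where
  "finite_automaton A \<longleftrightarrow> finite (states A)"

definition invertible_automaton :: "('q, 'x) automaton \<Rightarrow> bool" where
  "invertible_automaton A \<longleftrightarrow> (\<forall>q\<in>states A. bij (\<lambda>x. fst (trans A (q, x))))"

fun state_aut :: "('q, 'x) automaton \<Rightarrow> 'q \<Rightarrow> 'x list \<Rightarrow> 'x list" where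
  "state_aut A q [] = []"
| "state_aut A q (x # w) = fst (trans A (q, x)) # state_aut A (snd (trans A (q, x))) w"

definition automaton_group :: "('q, 'x) automaton \<Rightarrow> ('x list \<Rightarrow> 'x list) set" where
  "automaton_group A = generate Aut_T (state_aut A ` states A)"


lemma carrier_Aut_T:
  "g \<in> carrier Aut_T \<longleftrightarrow>
     bij g \<and> g [] = [] \<and> (\<forall>u v. tree_adj (g u) (g v) \<longleftrightarrow> tree_adj u v)"
  by (auto simp: Aut_tree_def tree_auts_def Bij_def)

lemma Aut_T_snoc:
  assumes "g \<in> carrier Aut_T"
  shows "\<exists>y. g (v @ [x]) = g v @ [y]"
proof (induction v arbitrary: x rule: rev_induct)
  case Nil
  have "tree_adj [] [x]" by (simp add: tree_adj_def)
  then have "tree_adj (g []) (g [x])" and "g [] = []"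
    using assms unfolding carrier_Aut_T by blast+
  then show ?case by (simp add: tree_adj_def)
next
  case (snoc z u)
  have "tree_adj (u @ [z]) ((u @ [z]) @ [x])" unfolding tree_adj_def by blast
  then have "tree_adj (g (u @ [z])) (g ((u @ [z]) @ [x]))"
    using assms unfolding carrier_Aut_T by blast
  moreover have "g (u @ [z]) \<noteq> g ((u @ [z]) @ [x]) @ [y]" for y
  proof
    assume eq: "g (u @ [z]) = g ((u @ [z]) @ [x]) @ [y]"
    with snoc.IH[of z] have "g u = g ((u @ [z]) @ [x])" by auto
    then have "u = (u @ [z]) @ [x]"
      using assms by (auto simp: carrier_Aut_T bij_def dest: injD)
    then show False by simp
  qed
  ultimately show ?case unfolding tree_adj_def by blast
qed

lemma length_Aut_T:
  assumes "g \<in> carrier Aut_T"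
  shows "length (g v) = length v"
  using assms
proof (induction v rule: rev_induct)
  case Nil
  then show ?case by (simp add: carrier_Aut_T)
next
  case (snoc x v)
  then show ?case using Aut_T_snoc[of g v x] by auto
qed

lemma section_eq:
  assumes "g \<in> carrier Aut_T"
  shows "g (v @ w) = g v @ tree_section g v w"
proof -
  have "\<exists>u. g (v @ w) = g v @ u"
  proof (induction w rule: rev_induct)
    case (snoc x w)
    then show ?case using Aut_T_snoc[OF assms, of "v @ w" x] by auto
  qed simp
  then show ?thesis
    using length_Aut_T[OF assms, of v] by (auto simp: tree_section_def)
qed

lemma tree_adj_append: "tree_adj (v @ a) (v @ b) \<longleftrightarrow> tree_adj a b"
  by (auto simp: tree_adj_def)

lemma section_in_Aut_T:
  assumes g: "g \<in> carrier Aut_T"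
  shows "tree_section g v \<in> carrier Aut_T"
proof -
  have eq: "g (v @ w) = g v @ tree_section g v w" for w
    by (rule section_eq[OF g])
  have "inj (tree_section g v)"
  proof (rule injI)
    fix a b assume "tree_section g v a = tree_section g v b"
    then have "g (v @ a) = g (v @ b)" by (simp add: eq)
    then show "a = b" using g by (auto simp: carrier_Aut_T bij_def dest: injD)
  qed
  moreover have "\<exists>w. tree_section g v w = u" for u
  proof -
    obtain z where z: "g z = g v @ u"
      using g by (metis carrier_Aut_T bij_pointE)
    have len: "length z = length v + length u"
      using z length_Aut_T[OF g, of z] length_Aut_T[OF g, of v] by simp
    define a where "a = take (length v) z"
    have "g z = g a @ tree_section g a (drop (length v) z)"
      using section_eq[OF g, of a "drop (length v) z"] by (simp add: a_def)
    moreover have "length (g a) = length (g v)"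
      using len by (simp add: length_Aut_T[OF g] a_def)
    ultimately have "g a = g v" using z by simp
    then have "a = v" using g by (auto simp: carrier_Aut_T bij_def dest: injD)
    then have "z = v @ drop (length v) z"
      by (metis a_def append_take_drop_id)
    then show ?thesis using z eq by (metis same_append_eq)
  qed
  ultimately have "bij (tree_section g v)"
    by (metis bijI surjI surj_def)
  moreover have "tree_section g v [] = []"
    using eq[of "[]"] by simp
  moreover have "tree_adj (tree_section g v a) (tree_section g v b) \<longleftrightarrow> tree_adj a b" for a b
    using g by (metis carrier_Aut_T eq tree_adj_append)
  ultimately show ?thesis by (simp add: carrier_Aut_T)
qed

lemma state_aut_in_Aut_T:
  assumes A: "is_automaton A" "invertible_automaton A" and "q \<in> states A"
  shows "state_aut A q \<in> carrier Aut_T"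
proof -
  have step: "snd (trans A (q, x)) \<in> states A" "bij (\<lambda>x. fst (trans A (q, x)))"
    if "q \<in> states A" for q x
    using A that by (auto simp: is_automaton_def invertible_automaton_def)
  have len: "length (state_aut A q w) = length w" for q w
    by (induction w arbitrary: q) auto
  have inj: "a = b" if "q \<in> states A" "state_aut A q a = state_aut A q b" for q a b
    using that
  proof (induction a arbitrary: q b)
    case Nil
    then show ?case using len[of q b] by simp
  next
    case (Cons x a)
    then obtain y c where b: "b = y # c" by (cases b) auto
    have "x = y" using Cons.prems step(2)[of q] by (auto simp: b bij_def dest: injD)
    then show ?case using Cons step(1)[of q x] by (auto simp: b)
  qed
  have surj: "\<exists>w. state_aut A q w = u" if "q \<in> states A" for q u
    using that
  proof (induction u arbitrary: q)
    case Nil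
    show ?case by (rule exI[of _ "[]"]) simp
  next
    case (Cons y u)
    obtain x where x: "fst (trans A (q, x)) = y"
      using surjD[OF bij_is_surj[OF step(2)[OF Cons.prems]], of y] by metis
    obtain w where "state_aut A (snd (trans A (q, x))) w = u"
      using Cons.IH[OF step(1)[OF Cons.prems, of x]] by blast
    then have "state_aut A q (x # w) = y # u" using x by simp
    then show ?case by blast
  qed
  have snoc: "\<exists>y. state_aut A q (v @ [x]) = state_aut A q v @ [y]" for q v x
    by (induction v arbitrary: q) auto
  have adj: "tree_adj (state_aut A q u) (state_aut A q v) \<longleftrightarrow> tree_adj u v"
    if q: "q \<in> states A" for u v
  proof -
    have ext: "\<exists>x. v = u @ [x]" if "state_aut A q v = state_aut A q u @ [y]" for u v y
    proof -
      have "length v = Suc (length u)" using that len by (metis length_append_singleton)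
      then obtain u' x where v: "v = u' @ [x]" by (metis length_Suc_conv_rev)
      then have "state_aut A q u' = state_aut A q u"
        using snoc[of q u' x] that by auto
      then show ?thesis using inj[OF q] v by blast
    qed
    show ?thesis unfolding tree_adj_def using ext snoc by meson
  qed
  have "bij (state_aut A q)"
  proof (rule bijI)
    show "inj (state_aut A q)" using inj[OF assms(3)] by (rule injI)
    show "surj (state_aut A q)" using surj[OF assms(3)] unfolding surj_def by metis
  qed
  then show ?thesis using adj assms(3) by (simp add: carrier_Aut_T)
qed

lemma mult_Aut_T:
  "g \<in> carrier Aut_T \<Longrightarrow> h \<in> carrier Aut_T \<Longrightarrow> g \<otimes>\<^bsub>Aut_T\<^esub> h = g \<circ> h"
  by (auto simp: Aut_tree_def tree_auts_def BijGroup_def compose_def)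

lemma level_stab_antimono:
  assumes "m \<le> n"
  shows "level_stab n \<subseteq> level_stab m"
proof
  fix g :: "'x list \<Rightarrow> 'x list" assume g: "g \<in> level_stab n"
  then have gA: "g \<in> carrier Aut_T" by (simp add: level_stab_def)
  have "g v = v" if v: "length v = m" for v
  proof -
    have "length (v @ replicate (n - m) undefined) = n" using v assms by simp
    then have "g (v @ replicate (n - m) undefined) = v @ replicate (n - m) undefined"
      using g unfolding level_stab_def by blast
    then have "g v @ tree_section g v (replicate (n - m) undefined) =
        v @ replicate (n - m) undefined"
      using section_eq[OF gA, of v "replicate (n - m) undefined"] by metis
    then show ?thesis
      using append_eq_append_conv[of "g v" v] length_Aut_T[OF gA, of v] by blast
  qed
  then show "g \<in> level_stab m" using gA by (simp add: level_stab_def)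
qed

lemma openin_Aut_T_topology:
  "openin Aut_T_topology U \<longleftrightarrow>
     U \<subseteq> carrier Aut_T \<and> (\<forall>g\<in>U. \<exists>n. g <#\<^bsub>Aut_T\<^esub> level_stab n \<subseteq> U)"
proof -
  have "istopology (\<lambda>U :: ('x list \<Rightarrow> 'x list) set. U \<subseteq> carrier Aut_T \<and>
          (\<forall>g\<in>U. \<exists>n. g <#\<^bsub>Aut_T\<^esub> level_stab n \<subseteq> U))" (is "istopology ?P")
    unfolding istopology_def
  proof (intro conjI allI impI)
    fix U V :: "('x list \<Rightarrow> 'x list) set" assume U: "?P U" and V: "?P V"
    show "U \<inter> V \<subseteq> carrier Aut_T" using U by blast
    show "\<forall>g\<in>U \<inter> V. \<exists>n. g <#\<^bsub>Aut_T\<^esub> level_stab n \<subseteq> U \<inter> V"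
    proof
      fix g assume "g \<in> U \<inter> V"
      then obtain m n where "g <#\<^bsub>Aut_T\<^esub> level_stab m \<subseteq> U" "g <#\<^bsub>Aut_T\<^esub> level_stab n \<subseteq> V"
        using U V by blast
      moreover have "g <#\<^bsub>Aut_T\<^esub> level_stab (max m n) \<subseteq> g <#\<^bsub>Aut_T\<^esub> level_stab k"
        if "k \<le> max m n" for k
        using level_stab_antimono[OF that] unfolding l_coset_def by blast
      ultimately have "g <#\<^bsub>Aut_T\<^esub> level_stab (max m n) \<subseteq> U \<inter> V"
        by (meson le_inf_iff max.cobounded1 max.cobounded2 subset_trans)
      then show "\<exists>n. g <#\<^bsub>Aut_T\<^esub> level_stab n \<subseteq> U \<inter> V" by blast
    qed
  next
    fix K :: "('x list \<Rightarrow> 'x list) set set" assume K: "\<forall>U\<in>K. ?P U"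
    show "\<Union>K \<subseteq> carrier Aut_T" using K by blast
    show "\<forall>g\<in>\<Union>K. \<exists>n. g <#\<^bsub>Aut_T\<^esub> level_stab n \<subseteq> \<Union>K"
      using K by (meson Union_iff Union_upper subset_trans)
  qed
  then show ?thesis
    unfolding Aut_T_topology_def by (subst topology_inverse') (assumption, rule refl)
qed

lemma topspace_Aut_T_topology: "topspace Aut_T_topology = carrier Aut_T"
proof
  show "topspace Aut_T_topology \<subseteq> carrier Aut_T"
    by (metis openin_Aut_T_topology openin_topspace)
  have comp: "g \<circ> h \<in> carrier Aut_T"
    if "g \<in> carrier Aut_T" "h \<in> carrier Aut_T" for g h :: "'x list \<Rightarrow> 'x list"
    using that by (simp add: carrier_Aut_T bij_comp)
  have "openin Aut_T_topology (carrier (Aut_T :: ('x list \<Rightarrow> 'x list) monoid))"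
    unfolding openin_Aut_T_topology
    by (auto simp: l_coset_def level_stab_def mult_Aut_T comp)
  then show "carrier Aut_T \<subseteq> topspace (Aut_T_topology :: ('x list \<Rightarrow> 'x list) topology)"
    by (rule openin_subset)
qed

end

theory Submission
  imports
    Defs
    "HOL-Algebra.Group_Action"
    "HOL-Algebra.Elementary_Groups"
    "HOL-Algebra.FiniteProduct"
    "HOL-Algebra.Multiplicative_Group"
    "HOL-Algebra.Sylow"
    "HOL-Algebra.Sym_Groups"
begin

text \<open>
  Let \<open>G\<close> be the group of finite type of \<open>P\<close>. A homomorphism \<open>\<phi>\<close> from \<open>G\<close> to a finite abelian
  group \<open>Q\<close> yields another one, \<open>g \<mapsto> \<Prod>x. \<phi> (g|\<^sub>x)\<close>, because \<open>(gh)|\<^sub>x = g|\<^bsub>h(x)\<^esub> h|\<^sub>x\<close>. Elements of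
  \<open>G\<close> that fix level \<open>D\<close> can be planted below any letter without leaving \<open>G\<close>; hence if a
  continuous \<open>\<phi>\<close> is nontrivial on the stabilizer of level \<open>D\<close>, iterating this
  construction gives infinitely many continuous homomorphisms to \<open>Q\<close>. A dense finitely generated
  subgroup allows only finitely many, so every continuous \<open>\<phi>\<close> is trivial on that stabilizer.

  For \<open>D > 0\<close> every level quotient of \<open>G\<close> is a \<open>p\<close>-group. If the automaton group \<open>H\<close> had a smaller
  image on some level than \<open>G\<close>, that image would lie in a proper normal subgroup with abelian
  quotient. The resulting homomorphism kills \<open>H\<close> and the stabilizer of level \<open>D\<close>, hence all of
  \<open>G\<close>, as \<open>H\<close> and \<open>G\<close> agree on level \<open>D\<close>: a contradiction. For \<open>D = 0\<close> the group \<open>G\<close> is all of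
  \<open>Aut(T)\<close>, and the sign of the action on the first level shows that it is not topologically
  finitely generated.
\<close>

section \<open>Finite p-groups\<close>

text \<open>By the orbit-stabilizer theorem every orbit has \<open>p\<close>-power size, so an orbit
  that is not a single fixed point has size divisible by \<open>p\<close>. The orbit of
  \<open>x\<close> contributes exactly 1 to \<open>card E\<close>; if no other orbit were a
  singleton, \<open>p\<close> would divide 1.\<close>

lemma (in group_action) another_fixed_point:
  assumes p: "prime (p::nat)" and ord: "order G = p ^ k"
    and fin: "finite E" and dvd: "p dvd card E"
    and x: "x \<in> E" "\<And>g. g \<in> carrier G \<Longrightarrow> \<phi> g x = x"
  shows "\<exists>y\<in>E. y \<noteq> x \<and> (\<forall>g\<in>carrier G. \<phi> g y = y)"
proof (rule ccontr)
  assume contr: "\<not> ?thesis"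
  have part: "partition E (orbits G E \<phi>)" by (rule orbit_partition)
  have sub: "U \<subseteq> E" if "U \<in> orbits G E \<phi>" for U
    using part that partition.incl by blast
  have finO: "finite (orbits G E \<phi>)"
    using sub fin by (meson PowI finite_Pow_iff finite_subset subsetI)
  have ox: "orbit G \<phi> x = {x}"
    using x orbit_refl[OF x(1)] by (auto simp: orbit_def)
  then have xO: "{x} \<in> orbits G E \<phi>" using x(1) unfolding orbits_def by blast
  have disj: "pairwise disjnt (orbits G E \<phi>)"
  proof (rule pairwiseI)
    fix U V assume UV: "U \<in> orbits G E \<phi>" "V \<in> orbits G E \<phi>" "U \<noteq> V"
    show "disjnt U V"
    proof (rule ccontr)
      assume "\<not> disjnt U V"
      then obtain z where "z \<in> U" "z \<in> V" by (auto simp: disjnt_iff)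
      then show False
        using UV partition.unique_class[OF part] sub by blast
    qed
  qed
  have "card E = card (\<Union>(orbits G E \<phi>))" by (simp add: orbits_coverture)
  also have "\<dots> = (\<Sum>U\<in>orbits G E \<phi>. card U)"
    using disj sub fin by (intro card_Union_disjoint) (auto intro: finite_subset)
  also have "\<dots> = 1 + (\<Sum>U\<in>orbits G E \<phi> - {{x}}. card U)"
    using finO xO by (subst sum.remove[of _ "{x}"]) auto
  finally have sum: "card E = 1 + (\<Sum>U\<in>orbits G E \<phi> - {{x}}. card U)" .
  have "p dvd card U" if "U \<in> orbits G E \<phi> - {{x}}" for U
  proof -
    obtain y where y: "y \<in> E" "U = orbit G \<phi> y"
      using \<open>U \<in> orbits G E \<phi> - {{x}}\<close> by (auto simp: orbits_def)
    have "card U dvd p ^ k"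
      using orbit_stabilizer_theorem[OF y(1)] ord y(2) by (metis dvd_triv_left)
    then obtain i where i: "card U = p ^ i"
      using divides_primepow_nat[OF p] by blast
    have "card U \<noteq> 1"
    proof
      assume "card U = 1"
      then obtain z where "U = {z}" by (auto simp: card_1_singleton_iff)
      then have U: "U = {y}" using orbit_refl[OF y(1)] y(2) by auto
      then have "y \<noteq> x" using that by auto
      moreover have "\<forall>g\<in>carrier G. \<phi> g y = y" using U y(2) by (auto simp: orbit_def)
      ultimately show False using contr y(1) by blast
    qed
    then show ?thesis using i by (cases i) auto
  qed
  then have "p dvd (\<Sum>U\<in>orbits G E \<phi> - {{x}}. card U)" by (rule dvd_sum)
  with dvd sum have "p dvd 1" by (metis dvd_add_left_iff)
  then show False using p by simp
qed

text \<open>The cosets here are right cosets, on which right multiplication reverses products; the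
  inverse turns it back into a homomorphism. Elements of \<open>BijGroup\<close> are extensional,
  hence the restricted lambda.\<close>

lemma (in group) right_translation_action:
  assumes H: "subgroup H G"
  shows "group_action G (rcosets H) (\<lambda>g. \<lambda>R\<in>rcosets H. R #> inv g)"
proof -
  have HG: "H \<subseteq> carrier G" by (rule subgroup.subset[OF H])
  have cl: "R #> g \<in> rcosets H" if "R \<in> rcosets H" "g \<in> carrier G" for R g
    using that HG by (auto simp: RCOSETS_def coset_mult_assoc)
  have sub: "R \<subseteq> carrier G" if "R \<in> rcosets H" for R
    using that rcosets_subset_PowG[OF H] by blast
  have bij: "(\<lambda>R\<in>rcosets H. R #> inv g) \<in> Bij (rcosets H)" if g: "g \<in> carrier G" for g
  proof -
    have "bij_betw (\<lambda>R. R #> inv g) (rcosets H) (rcosets H)"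
      by (rule bij_betwI[where g = "\<lambda>R. R #> g"])
        (use cl sub g in \<open>auto simp: coset_mult_assoc\<close>)
    then have "bij_betw (\<lambda>R\<in>rcosets H. R #> inv g) (rcosets H) (rcosets H)"
      by (metis (no_types, lifting) bij_betw_cong restrict_apply')
    then show ?thesis by (simp add: Bij_def)
  qed
  show ?thesis
    unfolding group_action_def group_hom_def group_hom_axioms_def
  proof (intro conjI is_group group_BijGroup homI)
    fix g h assume gh: "g \<in> carrier G" "h \<in> carrier G"
    show "(\<lambda>R\<in>rcosets H. R #> inv (g \<otimes> h)) =
      (\<lambda>R\<in>rcosets H. R #> inv g) \<otimes>\<^bsub>BijGroup (rcosets H)\<^esub> (\<lambda>R\<in>rcosets H. R #> inv h)"
      using gh bij[OF gh(1)] bij[OF gh(2)] cl sub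
      by (auto simp: BijGroup_def compose_def fun_eq_iff coset_mult_assoc inv_mult_group)
  qed (use bij in \<open>simp add: BijGroup_def\<close>)
qed

text \<open>Let \<open>H\<close> act by right translation on its own right cosets. Their number is a
  nontrivial power of \<open>p\<close> and the coset \<open>H\<close> is fixed, so some other coset
  \<open>H #> x\<close> is fixed too. That \<open>h\<close> fixes \<open>H #> x\<close> means that
  \<open>x\<close> conjugates \<open>h\<close> into \<open>H\<close>.\<close>

lemma (in group) p_group_normalizer_grows:
  assumes p: "prime (p::nat)" and ord: "order G = p ^ k"
    and H: "subgroup H G" "H \<noteq> carrier G"
  shows "\<exists>x\<in>carrier G - H. \<forall>h\<in>H. x \<otimes> h \<otimes> inv x \<in> H"
proof -
  have fin: "finite (carrier G)"
    using ord p by (metis order_gt_0_iff_finite prime_gt_0_nat zero_less_power)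
  have HG: "H \<subseteq> carrier G" by (rule subgroup.subset[OF H(1)])
  have lag: "card (rcosets H) * card H = p ^ k" using lagrange[OF H(1)] ord by simp
  have fr: "finite (rcosets H)"
    using rcosets_subset_PowG[OF H(1)] fin by (meson finite_Pow_iff finite_subset)
  obtain i where i: "card (rcosets H) = p ^ i"
    using lag divides_primepow_nat[OF p] by (metis dvd_triv_left)
  have "card H \<noteq> p ^ k"
    using H(2) HG fin ord by (metis card_subset_eq order_def)
  then have "i \<noteq> 0" using lag i by (cases i) auto
  then have dvd: "p dvd card (rcosets H)" using i by (cases i) auto
  obtain j where j: "order (G\<lparr>carrier := H\<rparr>) = p ^ j"
    using lag divides_primepow_nat[OF p] unfolding order_def
    by (metis dvd_triv_right partial_object.select_convs(1) partial_object.update_convs(1)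
        monoid.surjective)
  interpret act: group_action "G\<lparr>carrier := H\<rparr>" "rcosets H" "\<lambda>g. \<lambda>R\<in>rcosets H. R #> inv g"
    by (rule group_action.induced_action[OF right_translation_action[OF H(1)] H(1)])
  have HR: "H \<in> rcosets H" by (rule subgroup.subgroup_in_rcosets[OF H(1) is_group])
  have "\<exists>R\<in>rcosets H. R \<noteq> H \<and> (\<forall>g\<in>H. (\<lambda>R\<in>rcosets H. R #> inv g) R = R)"
    using act.another_fixed_point[OF p j fr dvd HR] HR H(1)
    by (simp add: subgroup.m_inv_closed subgroup.rcos_const[OF _ is_group])
  then obtain x where x: "x \<in> carrier G" "H #> x \<noteq> H"
    and fx: "\<And>g. g \<in> H \<Longrightarrow> (H #> x) #> inv g = H #> x"
    by (auto simp: RCOSETS_def)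
  have "x \<notin> H" using x(2) subgroup.rcos_const[OF H(1) is_group] by blast
  moreover have "x \<otimes> h \<otimes> inv x \<in> H" if h: "h \<in> H" for h
  proof -
    have hG: "h \<in> carrier G" using h HG by blast
    have "(H #> x) #> h = H #> x"
      using fx[of "inv h"] subgroup.m_inv_closed[OF H(1) h] hG by simp
    then have "H #> (x \<otimes> h) = H #> x" using x(1) hG HG by (simp add: coset_mult_assoc)
    then have "H #> (x \<otimes> h \<otimes> inv x) = H"
      using x(1) hG HG by (metis coset_mult_assoc coset_mult_inv2 inv_closed m_closed coset_mult_one r_inv)
    then show ?thesis
      using x(1) hG H(1) by (simp add: coset_join1)
  qed
  ultimately show ?thesis using x(1) by blast
qed

text \<open>Take for \<open>N\<close> a maximal proper subgroup \<open>M\<close> above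
  \<open>H\<close>. Its normalizer is strictly larger, hence the whole group, so \<open>M\<close> is
  normal. By maximality again the quotient is generated by any coset other than \<open>M\<close>, so
  it is cyclic.\<close>

lemma (in group) p_group_abelian_quotient:
  assumes p: "prime (p::nat)" and ord: "order G = p ^ k"
    and H: "subgroup H G" "H \<noteq> carrier G"
  shows "\<exists>N. N \<lhd> G \<and> H \<subseteq> N \<and> N \<noteq> carrier G \<and> comm_group (G Mod N)"
proof -
  have fin: "finite (carrier G)"
    using ord p by (metis order_gt_0_iff_finite prime_gt_0_nat zero_less_power)
  define \<S> where "\<S> = {K. subgroup K G \<and> H \<subseteq> K \<and> K \<noteq> carrier G}"
  have "\<S> \<subseteq> Pow (carrier G)" by (auto simp: \<S>_def dest: subgroup.subset)
  then have "finite \<S>" using fin by (meson finite_Pow_iff finite_subset)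
  moreover have "H \<in> \<S>" using H by (simp add: \<S>_def)
  ultimately obtain M where M: "M \<in> \<S>" and max: "\<And>K. K \<in> \<S> \<Longrightarrow> M \<subseteq> K \<Longrightarrow> K = M"
    using finite_has_maximal[of \<S>] by (metis empty_iff)
  have MG: "subgroup M G" "H \<subseteq> M" "M \<noteq> carrier G" using M by (auto simp: \<S>_def)
  have Msub: "M \<subseteq> carrier G" by (rule subgroup.subset[OF MG(1)])
  have over: "K = carrier G" if "subgroup K G" "M \<subseteq> K" "a \<in> K" "a \<notin> M" for K a
    using max[of K] that MG by (auto simp: \<S>_def)
  \<comment> \<open>\<open>K\<close> is the normalizer of \<open>M\<close>. Demanding equality of
    the image gives closure under inverses; since \<open>M\<close> is finite and conjugation
    injective, inclusion already implies equality, which is \<open>KI\<close>.\<close>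
  define K where "K = {x \<in> carrier G. (\<lambda>h. x \<otimes> h \<otimes> inv x) ` M = M}"
  have inj: "inj_on (\<lambda>h. x \<otimes> h \<otimes> inv x) M" if "x \<in> carrier G" for x
    using that Msub by (intro inj_onI) (simp add: subset_iff)
  have KI: "x \<in> K" if "x \<in> carrier G" "\<forall>h\<in>M. x \<otimes> h \<otimes> inv x \<in> M" for x
    using that endo_inj_surj[OF finite_subset[OF Msub fin] _ inj[OF that(1)]] unfolding K_def by blast
  have KD: "x \<otimes> h \<otimes> inv x \<in> M" if "x \<in> K" "h \<in> M" for x h
    using that unfolding K_def by blast
  have "subgroup K G"
  proof (rule subgroupI)
    show "K \<subseteq> carrier G" by (auto simp: K_def)
    have "\<one> \<in> K" using Msub by (intro KI) auto
    then show "K \<noteq> {}" by blast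
  next
    fix a assume a: "a \<in> K"
    then have aG: "a \<in> carrier G" by (simp add: K_def)
    show "inv a \<in> K"
    proof (rule KI)
      show "\<forall>h\<in>M. inv a \<otimes> h \<otimes> inv (inv a) \<in> M"
      proof
        fix h assume "h \<in> M"
        then obtain h' where h': "h' \<in> M" "h = a \<otimes> h' \<otimes> inv a"
          using a unfolding K_def by blast
        then have "inv a \<otimes> h \<otimes> inv (inv a) = h'"
          using aG Msub by (simp add: m_assoc[symmetric] subset_iff) (simp add: m_assoc subset_iff)
        then show "inv a \<otimes> h \<otimes> inv (inv a) \<in> M" using h' by simp
      qed
    qed (use aG in simp)
    fix b assume b: "b \<in> K"
    then have bG: "b \<in> carrier G" by (simp add: K_def)
    show "a \<otimes> b \<in> K"
    proof (rule KI)
      show "\<forall>h\<in>M. a \<otimes> b \<otimes> h \<otimes> inv (a \<otimes> b) \<in> M"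
      proof
        fix h assume h: "h \<in> M"
        have "a \<otimes> (b \<otimes> h \<otimes> inv b) \<otimes> inv a \<in> M" by (rule KD[OF a KD[OF b h]])
        moreover have "a \<otimes> (b \<otimes> h \<otimes> inv b) \<otimes> inv a = a \<otimes> b \<otimes> h \<otimes> inv (a \<otimes> b)"
          using aG bG h Msub by (simp add: m_assoc inv_mult_group subset_iff)
        ultimately show "a \<otimes> b \<otimes> h \<otimes> inv (a \<otimes> b) \<in> M" by simp
      qed
    qed (use aG bG in simp)
  qed
  moreover have "M \<subseteq> K"
    using MG(1) Msub by (intro subsetI KI) (auto simp: subgroup.m_closed subgroup.m_inv_closed)
  moreover obtain x where x: "x \<in> carrier G" "x \<notin> M" "\<forall>h\<in>M. x \<otimes> h \<otimes> inv x \<in> M"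
    using p_group_normalizer_grows[OF p ord MG(1,3)] by blast
  moreover have "x \<in> K" using x KI by blast
  ultimately have "K = carrier G" using over by blast
  then have N: "M \<lhd> G" using KD MG(1) by (intro normal_invI) auto
  interpret N: normal M G by (rule N)
  interpret Q: group "G Mod M" by (rule N.factorgroup_is_group)
  define C where "C = generate (G Mod M) {M #> x}"
  have Cs: "subgroup C (G Mod M)"
    unfolding C_def using x(1) by (intro Q.generate_is_subgroup) (auto simp: FactGroup_def RCOSETS_def)
  \<comment> \<open>\<open>L\<close> is the preimage of the cyclic subgroup \<open>C\<close>. It
    contains \<open>M\<close> and also \<open>x\<close>, which is not in \<open>M\<close>, so it is
    the whole group and \<open>C\<close> is the whole quotient.\<close>
  define L where "L = {y \<in> carrier G. M #> y \<in> C}"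
  interpret f: group_hom G "G Mod M" "(#>) M"
    using N.r_coset_hom_Mod is_group Q.is_group by (simp add: group_hom_def group_hom_axioms_def)
  have "subgroup L G"
    unfolding L_def
    by (rule subgroupI)
      (use subgroup.one_closed[OF Cs] subgroup.m_closed[OF Cs] subgroup.m_inv_closed[OF Cs] in
        \<open>auto simp: coset_mult_one[OF Msub] intro!: exI[of _ \<one>]\<close>)
  moreover have "M \<subseteq> L"
    using Msub subgroup.one_closed[OF Cs] subgroup.rcos_const[OF MG(1) is_group]
    by (auto simp: L_def FactGroup_def)
  moreover have "x \<in> L" using x(1) by (simp add: L_def C_def generate.incl)
  ultimately have L: "L = carrier G" using over x(2) by blast
  have "carrier (G Mod M) = C"
    using L subgroup.subset[OF Cs] by (auto simp: L_def FactGroup_def RCOSETS_def)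
  then have "cyclic_group (G Mod M)"
    using f.hom_closed[OF x(1)] unfolding cyclic_group_def subgroup_generated_def C_def
    by (intro bexI[of _ "M #> x"]) (auto simp: Int_absorb1)
  then have "comm_group (G Mod M)" by (rule Q.cyclic_imp_abelian_group)
  then show ?thesis using N MG by blast
qed

section \<open>Automorphisms of the rooted tree\<close>

lemma group_Aut_tree:
  assumes V: "[] \<in> V"
  shows "group (Aut_tree V)"
proof -
  interpret B: group "BijGroup V" by (rule group_BijGroup)
  have V': "g v \<in> V" if "g \<in> Bij V" "v \<in> V" for g v
    using Bij_imp_funcset[OF that(1)] that(2) by blast
  have "subgroup (tree_auts V) (BijGroup V)"
  proof (rule B.subgroupI)
    show "tree_auts V \<subseteq> carrier (BijGroup V)" by (auto simp: tree_auts_def BijGroup_def)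
    have "(\<lambda>x\<in>V. x) \<in> tree_auts V" using V by (auto simp: tree_auts_def id_Bij)
    then show "tree_auts V \<noteq> {}" by blast
  next
    fix g assume g: "g \<in> tree_auts V"
    then have gB: "g \<in> Bij V" by (simp add: tree_auts_def)
    let ?h = "\<lambda>x\<in>V. inv_into V g x"
    have r: "g (?h v) = v" if "v \<in> V" for v
      using gB that by (auto simp: Bij_def bij_betw_def f_inv_into_f)
    have l: "?h (g v) = v" if "v \<in> V" for v
      using gB that by (auto simp: Bij_def bij_betw_def inv_into_f_f)
    have hV: "?h v \<in> V" if "v \<in> V" for v
      using V'[OF restrict_inv_into_Bij[OF gB] that] .
    have adj: "tree_adj (g u) (g v) \<longleftrightarrow> tree_adj u v" if "u \<in> V" "v \<in> V" for u v
      using g that by (simp add: tree_auts_def)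
    have "g [] = []" using g by (simp add: tree_auts_def)
    then have "?h [] = []" using l[OF V] by (simp only:)
    moreover have "tree_adj (?h u) (?h v) \<longleftrightarrow> tree_adj u v" if "u \<in> V" "v \<in> V" for u v
      using adj[OF hV[OF that(1)] hV[OF that(2)]] unfolding r[OF that(1)] r[OF that(2)]
      by (rule sym)
    ultimately show "inv\<^bsub>BijGroup V\<^esub> g \<in> tree_auts V"
      unfolding inv_BijGroup[OF gB] tree_auts_def using restrict_inv_into_Bij[OF gB] by blast
    fix h assume h: "h \<in> tree_auts V"
    then have hB: "h \<in> Bij V" by (simp add: tree_auts_def)
    show "g \<otimes>\<^bsub>BijGroup V\<^esub> h \<in> tree_auts V"
      using g h gB hB compose_Bij[OF gB hB] V V'[OF hB]
      by (auto simp: tree_auts_def BijGroup_def compose_eq)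
  qed
  then show ?thesis unfolding Aut_tree_def by (rule B.subgroup_imp_group)
qed

interpretation Aut_T: group Aut_T
  by (rule group_Aut_tree) simp

interpretation Aut_trunc: group "Aut_T_trunc n" for n
  by (rule group_Aut_tree) (simp add: trunc_tree_def)

lemma one_Aut_T: "\<one>\<^bsub>Aut_T\<^esub> = id"
  by (auto simp: Aut_tree_def BijGroup_def)

lemma comp_in_Aut_T:
  "g \<in> carrier Aut_T \<Longrightarrow> h \<in> carrier Aut_T \<Longrightarrow> g \<circ> h \<in> carrier Aut_T"
  using Aut_T.m_closed mult_Aut_T by metis

lemma id_in_Aut_T: "id \<in> carrier Aut_T"
  using Aut_T.one_closed one_Aut_T by metis

text \<open>Sending children to children forces \<open>g\<close> to preserve lengths. If
  \<open>g v\<close> is a child of \<open>g u\<close>, then \<open>v\<close> is a child of some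
  \<open>u'\<close> with \<open>g u' = g u\<close>, and injectivity gives \<open>u' = u\<close>; so
  adjacency is also reflected.\<close>

lemma carrier_Aut_TI:
  assumes bij: "bij g" and nil: "g [] = []" and snoc: "\<And>v x. \<exists>y. g (v @ [x]) = g v @ [y]"
  shows "g \<in> carrier Aut_T"
proof -
  have len: "length (g v) = length v" for v
  proof (induction v rule: rev_induct)
    case (snoc x v)
    then show ?case using assms(3)[of v x] by auto
  qed (simp add: nil)
  have ext: "\<exists>x. v = u @ [x]" if "g v = g u @ [y]" for u v y
  proof -
    have "length v = Suc (length u)" using that len by (metis length_append_singleton)
    then obtain u' x where v: "v = u' @ [x]" by (metis length_Suc_conv_rev)
    then have "g u' = g u" using snoc[of u' x] that by auto
    then show ?thesis using bij v by (auto simp: bij_def dest: injD)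
  qed
  have "tree_adj (g u) (g v) \<longleftrightarrow> tree_adj u v" for u v
    unfolding tree_adj_def using ext snoc by meson
  then show ?thesis using bij nil by (simp add: carrier_Aut_T)
qed

lemma tree_section_comp:
  assumes "g \<in> carrier Aut_T" "h \<in> carrier Aut_T"
  shows "tree_section (g \<circ> h) v = tree_section g (h v) \<circ> tree_section h v"
proof
  fix w
  have "(g \<circ> h) (v @ w) = g (h v) @ tree_section g (h v) (tree_section h v w)"
    using section_eq[OF assms(2), of v w] section_eq[OF assms(1), of "h v"] by simp
  then show "tree_section (g \<circ> h) v w = (tree_section g (h v) \<circ> tree_section h v) w"
    using section_eq[OF comp_in_Aut_T[OF assms], of v w] by simp
qed

lemma tree_section_append:
  assumes "g \<in> carrier Aut_T"
  shows "tree_section g (u @ v) = tree_section (tree_section g u) v"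
proof
  fix w
  have "g u @ tree_section g u v @ tree_section g (u @ v) w =
      g u @ tree_section g u v @ tree_section (tree_section g u) v w"
    using section_eq[OF assms, of "u @ v" w] section_eq[OF assms, of u "v @ w"]
      section_eq[OF assms, of u v] section_eq[OF section_in_Aut_T[OF assms], of u v w]
    by simp
  then show "tree_section g (u @ v) w = tree_section (tree_section g u) v w" by simp
qed

lemma tree_section_Nil: "tree_section g [] = g"
  by (simp add: tree_section_def)

lemma tree_section_id: "tree_section id v = id"
  by (auto simp: tree_section_def)

section \<open>Restriction to finite levels and the topology of Aut(T)\<close>

lemma tree_proj_eq_iff:
  assumes g: "g \<in> carrier Aut_T" and h: "h \<in> carrier Aut_T"
  shows "tree_proj n g = tree_proj n h \<longleftrightarrow> (\<forall>v. length v = n \<longrightarrow> g v = h v)"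
proof
  assume eq: "tree_proj n g = tree_proj n h"
  show "\<forall>v. length v = n \<longrightarrow> g v = h v"
  proof (intro allI impI)
    fix v :: "'a list" assume "length v = n"
    then show "g v = h v" using fun_cong[OF eq, of v] by (simp add: tree_proj_def trunc_tree_def)
  qed
next
  assume eq: "\<forall>v. length v = n \<longrightarrow> g v = h v"
  have "g v = h v" if "length v \<le> n" for v
  proof -
    \<comment> \<open>Padding \<open>v\<close> to a word of length \<open>n\<close> with an
      arbitrary letter reduces shorter words to level \<open>n\<close>, because automorphisms
      preserve prefixes.\<close>
    let ?r = "replicate (n - length v) undefined"
    have "g (v @ ?r) = h (v @ ?r)" using that eq by simp
    then show ?thesis
      using section_eq[OF g, of v ?r] section_eq[OF h, of v ?r]
        length_Aut_T[OF g, of v] length_Aut_T[OF h, of v]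
      by (metis append_eq_append_conv)
  qed
  then show "tree_proj n g = tree_proj n h"
    by (auto simp: tree_proj_def trunc_tree_def)
qed

lemma tree_proj_mono:
  assumes "tree_proj n g = tree_proj n h" "m \<le> n"
  shows "tree_proj m g = tree_proj m h"
proof -
  have "g v = h v" if "length v \<le> m" for v
    using fun_cong[OF assms(1), of v] that assms(2)
    by (simp add: tree_proj_def trunc_tree_def)
  then show ?thesis by (auto simp: tree_proj_def trunc_tree_def)
qed

lemma tree_proj_section_cong:
  assumes g: "g \<in> carrier Aut_T" and h: "h \<in> carrier Aut_T"
    and eq: "tree_proj (length v + n) g = tree_proj (length v + n) h"
  shows "tree_proj n (tree_section g v) = tree_proj n (tree_section h v)"
proof -
  have "g (v @ w) = h (v @ w)" if "length w = n" for w
    using eq that unfolding tree_proj_eq_iff[OF g h] by simp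
  then show ?thesis
    unfolding tree_proj_eq_iff[OF section_in_Aut_T[OF g] section_in_Aut_T[OF h]]
    by (simp add: tree_section_def)
qed

lemma level_stab_iff:
  "g \<in> level_stab n \<longleftrightarrow> g \<in> carrier Aut_T \<and> tree_proj n g = tree_proj n id"
  using tree_proj_eq_iff[of g id n] id_in_Aut_T by (auto simp: level_stab_def)

lemma tree_proj_in_carrier:
  assumes g: "g \<in> carrier Aut_T"
  shows "tree_proj n g \<in> carrier (Aut_T_trunc n)"
proof -
  have bij: "bij g" using g by (simp add: carrier_Aut_T)
  have len: "length (g v) = length v" for v by (rule length_Aut_T[OF g])
  have "g ` trunc_tree n = trunc_tree n"
  proof
    show "g ` trunc_tree n \<subseteq> trunc_tree n" by (auto simp: trunc_tree_def len)
    show "trunc_tree n \<subseteq> g ` trunc_tree n"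
    proof
      fix v :: "'a list" assume v: "v \<in> trunc_tree n"
      obtain u where u: "g u = v" using bij by (metis bij_pointE)
      then have "u \<in> trunc_tree n" using v len[of u] by (simp add: trunc_tree_def)
      then show "v \<in> g ` trunc_tree n" using u by blast
    qed
  qed
  moreover have "inj_on g (trunc_tree n)"
    using bij by (meson bij_is_inj inj_on_subset subset_UNIV)
  ultimately have "bij_betw (tree_proj n g) (trunc_tree n) (trunc_tree n)"
    unfolding tree_proj_def by (simp add: bij_betw_def inj_on_restrict_eq)
  then show ?thesis
    using g by (auto simp: Aut_tree_def tree_auts_def Bij_def tree_proj_def carrier_Aut_T
        trunc_tree_def)
qed

interpretation tree_proj: group_hom Aut_T "Aut_T_trunc n" "tree_proj n" for n
proof (unfold_locales, rule homI)
  fix g h :: "'a list \<Rightarrow> 'a list" assume g: "g \<in> carrier Aut_T" and h: "h \<in> carrier Aut_T"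
  have "tree_proj n g \<in> Bij (trunc_tree n)" "tree_proj n h \<in> Bij (trunc_tree n)"
    using tree_proj_in_carrier[OF g, of n] tree_proj_in_carrier[OF h, of n]
    by (auto simp: Aut_tree_def tree_auts_def)
  then show "tree_proj n (g \<otimes>\<^bsub>Aut_T\<^esub> h) = tree_proj n g \<otimes>\<^bsub>Aut_T_trunc n\<^esub> tree_proj n h"
    using length_Aut_T[OF h] unfolding mult_Aut_T[OF g h]
    by (auto simp: Aut_tree_def BijGroup_def tree_proj_def compose_def trunc_tree_def)
qed (rule tree_proj_in_carrier)

lemma tree_proj_comp:
  "g \<in> carrier Aut_T \<Longrightarrow> h \<in> carrier Aut_T \<Longrightarrow>
    tree_proj n (g \<circ> h) = tree_proj n g \<otimes>\<^bsub>Aut_T_trunc n\<^esub> tree_proj n h"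
  using tree_proj.hom_mult mult_Aut_T by metis

lemma tree_proj_id: "tree_proj n id = \<one>\<^bsub>Aut_T_trunc n\<^esub>"
  using tree_proj.hom_one one_Aut_T by metis

lemma finite_Aut_trunc: "finite (carrier (Aut_T_trunc n :: ('x::finite list \<Rightarrow> 'x list) monoid))"
proof (rule finite_subset)
  show "carrier (Aut_T_trunc n) \<subseteq> (\<Pi>\<^sub>E v\<in>(trunc_tree n :: 'x list set). trunc_tree n)"
    by (auto simp: Aut_tree_def tree_auts_def Bij_def bij_betw_def PiE_def)
  have "finite (trunc_tree n :: 'x list set)"
    using finite_lists_length_le[of "UNIV :: 'x set" n] by (simp add: trunc_tree_def)
  then show "finite (\<Pi>\<^sub>E v\<in>(trunc_tree n :: 'x list set). (trunc_tree n :: 'x list set))"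
    by (intro finite_PiE) auto
qed

text \<open>The cosets that define the topology are the fibres of the projections. This turns
  topological statements into statements about finite levels, and equality on a level into a
  factorization \<open>g = h s\<close> with \<open>s\<close> in a level stabilizer.\<close>

lemma l_coset_level_stab:
  assumes g: "g \<in> carrier Aut_T"
  shows "g <#\<^bsub>Aut_T\<^esub> level_stab n = {h \<in> carrier Aut_T. tree_proj n h = tree_proj n g}"
proof (intro equalityI subsetI)
  fix h assume "h \<in> g <#\<^bsub>Aut_T\<^esub> level_stab n"
  then obtain k where k: "k \<in> level_stab n" "h = g \<otimes>\<^bsub>Aut_T\<^esub> k" by (auto simp: l_coset_def)
  then show "h \<in> {h \<in> carrier Aut_T. tree_proj n h = tree_proj n g}"
    using g by (simp add: level_stab_iff tree_proj_id)
next
  fix h assume h: "h \<in> {h \<in> carrier Aut_T. tree_proj n h = tree_proj n g}"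
  let ?k = "inv\<^bsub>Aut_T\<^esub> g \<otimes>\<^bsub>Aut_T\<^esub> h"
  have "?k \<in> level_stab n"
    using g h tree_proj.hom_closed[OF g, of n] by (simp add: level_stab_iff tree_proj_id)
  moreover have "g \<otimes>\<^bsub>Aut_T\<^esub> ?k = h" using g h by (simp add: Aut_T.m_assoc[symmetric])
  ultimately show "h \<in> g <#\<^bsub>Aut_T\<^esub> level_stab n" by (force simp: l_coset_def)
qed

lemma closure_of_Aut_T_iff:
  assumes H: "H \<subseteq> carrier Aut_T"
  shows "g \<in> Aut_T_topology closure_of H \<longleftrightarrow>
    g \<in> carrier Aut_T \<and> (\<forall>n. \<exists>h\<in>H. tree_proj n h = tree_proj n g)"
proof
  assume cl: "g \<in> Aut_T_topology closure_of H"
  then have g: "g \<in> carrier Aut_T"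
    by (metis closure_of_subset_topspace subsetD topspace_Aut_T_topology)
  have "\<exists>h\<in>H. tree_proj n h = tree_proj n g" for n
  proof -
    define U where "U = {h \<in> carrier Aut_T. tree_proj n h = tree_proj n g}"
    have "openin Aut_T_topology U"
      unfolding openin_Aut_T_topology U_def by (auto simp: l_coset_level_stab intro!: exI[of _ n])
    moreover have "g \<in> U" using g by (simp add: U_def)
    ultimately have "\<exists>h. h \<in> H \<and> h \<in> U" using cl unfolding in_closure_of by blast
    then show ?thesis by (auto simp: U_def)
  qed
  then show "g \<in> carrier Aut_T \<and> (\<forall>n. \<exists>h\<in>H. tree_proj n h = tree_proj n g)" using g by blast
next
  assume g: "g \<in> carrier Aut_T \<and> (\<forall>n. \<exists>h\<in>H. tree_proj n h = tree_proj n g)"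
  have "\<exists>y\<in>H. y \<in> U" if U: "g \<in> U" "openin Aut_T_topology U" for U
  proof -
    obtain n where "g <#\<^bsub>Aut_T\<^esub> level_stab n \<subseteq> U"
      using U unfolding openin_Aut_T_topology by blast
    moreover obtain h where "h \<in> H" "tree_proj n h = tree_proj n g" using g by blast
    ultimately show ?thesis using g H by (auto simp: l_coset_level_stab)
  qed
  then show "g \<in> Aut_T_topology closure_of H"
    using g unfolding in_closure_of topspace_Aut_T_topology by blast
qed

section \<open>Action on the first level and automorphisms supported below one letter\<close>

definition root_perm :: "('x list \<Rightarrow> 'x list) \<Rightarrow> 'x \<Rightarrow> 'x" where
  "root_perm g x = hd (g [x])"

lemma singleton_root_perm:
  assumes "g \<in> carrier Aut_T"
  shows "g [x] = [root_perm g x]"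
  using length_Aut_T[OF assms, of "[x]"] by (cases "g [x]") (auto simp: root_perm_def)

lemma bij_root_perm:
  assumes g: "g \<in> carrier Aut_T"
  shows "bij (root_perm g)"
proof (rule bijI)
  have b: "bij g" using g by (simp add: carrier_Aut_T)
  show "inj (root_perm g)"
    using b singleton_root_perm[OF g] by (metis bij_is_inj injD injI list.inject)
  have "\<exists>x. y = root_perm g x" for y
  proof -
    obtain v where v: "g v = [y]" using b by (metis bij_pointE)
    then have "length v = 1" using length_Aut_T[OF g, of v] by simp
    then obtain x where "v = [x]" by (metis length_0_conv length_Suc_conv One_nat_def)
    then show ?thesis using v by (intro exI[of _ x]) (simp add: root_perm_def)
  qed
  then show "surj (root_perm g)" by blast
qed

lemma root_perm_comp:
  assumes "g \<in> carrier Aut_T" "h \<in> carrier Aut_T"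
  shows "root_perm (g \<circ> h) = root_perm g \<circ> root_perm h"
  using singleton_root_perm[OF assms(2)] by (auto simp: root_perm_def)

fun at_letter :: "'x \<Rightarrow> ('x list \<Rightarrow> 'x list) \<Rightarrow> 'x list \<Rightarrow> 'x list" where
  "at_letter x s [] = []"
| "at_letter x s (y # w) = y # (if y = x then s w else w)"

lemma at_letter_in_Aut_T:
  assumes s: "s \<in> carrier Aut_T"
  shows "at_letter x s \<in> carrier Aut_T"
proof (rule carrier_Aut_TI)
  have b: "bij s" using s by (simp add: carrier_Aut_T)
  show "bij (at_letter x s)"
  proof (rule bijI)
    show "inj (at_letter x s)"
    proof (rule injI)
      fix u v assume "at_letter x s u = at_letter x s v"
      then show "u = v"
        using b by (cases u; cases v) (auto split: if_splits dest: injD[OF bij_is_inj])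
    qed
    have "\<exists>v. u = at_letter x s v" for u
    proof (cases u)
      case Nil
      then show ?thesis by (intro exI[of _ "[]"]) simp
    next
      case (Cons y w)
      obtain w' where "s w' = w" using b by (metis bij_pointE)
      then show ?thesis
        using Cons by (intro exI[of _ "y # (if y = x then w' else w)"]) simp
    qed
    then show "surj (at_letter x s)" by blast
  qed
  show "\<exists>y. at_letter x s (v @ [z]) = at_letter x s v @ [y]" for v z
    using Aut_T_snoc[OF s] s by (cases v) (auto simp: carrier_Aut_T)
qed simp

lemma section_at_letter: "tree_section (at_letter x s) [y] = (if y = x then s else id)"
  by (auto simp: tree_section_def)

lemma at_letter_level_stab:
  assumes "s \<in> level_stab n"
  shows "at_letter x s \<in> level_stab (Suc n)"
proof -
  have s: "s \<in> carrier Aut_T" "\<And>v. length v = n \<Longrightarrow> s v = v"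
    using assms by (auto simp: level_stab_def)
  then show ?thesis
    by (auto simp: level_stab_def at_letter_in_Aut_T length_Suc_conv)
qed

lemma section_level_stab:
  assumes "g \<in> level_stab (Suc n)"
  shows "tree_section g [x] \<in> level_stab n"
proof -
  have "g \<in> carrier Aut_T" using assms by (simp add: level_stab_def)
  then show ?thesis
    using assms by (auto simp: level_stab_def section_in_Aut_T) (simp add: tree_section_def)
qed

section \<open>Homomorphisms from groups of finite type to abelian groups\<close>

locale pattern_group =
  fixes D :: nat and P :: "('x::finite list \<Rightarrow> 'x list) set"
  assumes pattern_subgroup: "subgroup P (Aut_T_trunc D)"
begin

abbreviation G :: "('x list \<Rightarrow> 'x list) set" where
  "G \<equiv> finite_type_group D P"

abbreviation \<Gamma> :: "('x list \<Rightarrow> 'x list) monoid" where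
  "\<Gamma> \<equiv> Aut_T\<lparr>carrier := G\<rparr>"

lemma G_in_Aut_T: "g \<in> G \<Longrightarrow> g \<in> carrier Aut_T"
  by (simp add: finite_type_group_def)

lemma G_pattern: "g \<in> G \<Longrightarrow> tree_proj D (tree_section g v) \<in> P"
  by (simp add: finite_type_group_def)

lemma G_proj: "g \<in> G \<Longrightarrow> tree_proj D g \<in> P"
  using G_pattern[of g "[]"] by (simp add: tree_section_Nil)

lemma id_proj: "tree_proj D id \<in> P"
  using subgroup.one_closed[OF pattern_subgroup] by (simp add: tree_proj_id)

text \<open>By the cocycle rule \<open>tree_section_comp\<close>, a pattern of a product is a
  product of patterns of the factors, and the pattern of the inverse at \<open>v\<close> is the
  inverse of the pattern of \<open>g\<close> at the preimage of \<open>v\<close>.\<close>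

lemma subgroup_G: "subgroup G Aut_T"
proof (rule Aut_T.subgroupI)
  show "G \<subseteq> carrier Aut_T" using G_in_Aut_T by blast
  have "id \<in> G" using id_proj id_in_Aut_T by (simp add: finite_type_group_def tree_section_id)
  then show "G \<noteq> {}" by blast
next
  fix g assume g: "g \<in> G"
  note gA = G_in_Aut_T[OF g]
  let ?k = "inv\<^bsub>Aut_T\<^esub> g"
  have kA: "?k \<in> carrier Aut_T" using gA by simp
  have gk: "g \<circ> ?k = id" using gA kA by (metis Aut_T.r_inv mult_Aut_T one_Aut_T)
  have "tree_proj D (tree_section ?k v) \<in> P" for v
  proof -
    let ?a = "tree_section g (?k v)" and ?b = "tree_section ?k v"
    have aA: "?a \<in> carrier Aut_T" and bA: "?b \<in> carrier Aut_T"
      using section_in_Aut_T gA kA by blast+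
    have "?a \<circ> ?b = id" using tree_section_comp[OF gA kA, of v] gk tree_section_id by metis
    then have "tree_proj D ?a \<otimes>\<^bsub>Aut_T_trunc D\<^esub> tree_proj D ?b = \<one>\<^bsub>Aut_T_trunc D\<^esub>"
      using tree_proj_comp[OF aA bA, of D] tree_proj_id by metis
    then have "tree_proj D ?b = inv\<^bsub>Aut_T_trunc D\<^esub> (tree_proj D ?a)"
      using Aut_trunc.inv_equality Aut_trunc.inv_inv tree_proj_in_carrier aA bA by metis
    then show ?thesis
      using subgroup.m_inv_closed[OF pattern_subgroup G_pattern[OF g]] by metis
  qed
  then show "?k \<in> G" using kA by (simp add: finite_type_group_def)
  fix h assume h: "h \<in> G"
  note hA = G_in_Aut_T[OF h]
  have "tree_proj D (tree_section (g \<circ> h) v) \<in> P" for v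
    using subgroup.m_closed[OF pattern_subgroup G_pattern[OF g, of "h v"] G_pattern[OF h, of v]]
      tree_section_comp[OF gA hA] tree_proj_comp section_in_Aut_T[OF gA] section_in_Aut_T[OF hA]
    by metis
  then show "g \<otimes>\<^bsub>Aut_T\<^esub> h \<in> G"
    using gA hA comp_in_Aut_T by (simp add: mult_Aut_T finite_type_group_def)
qed

sublocale \<Gamma>: group \<Gamma>
  by (rule Aut_T.subgroup_imp_group[OF subgroup_G])

lemma section_in_G:
  assumes g: "g \<in> G"
  shows "tree_section g v \<in> G"
proof -
  have "tree_proj D (tree_section (tree_section g v) w) \<in> P" for w
    using G_pattern[OF g, of "v @ w"] unfolding tree_section_append[OF G_in_Aut_T[OF g]] .
  then show ?thesis
    using section_in_Aut_T[OF G_in_Aut_T[OF g]] by (simp add: finite_type_group_def)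
qed

text \<open>The condition at \<open>v\<close> depends only on the action on levels up to
  \<open>length v + D\<close>, so it passes to limits.\<close>

lemma G_closed:
  assumes g: "g \<in> carrier Aut_T" and approx: "\<And>n. \<exists>h\<in>G. tree_proj n h = tree_proj n g"
  shows "g \<in> G"
proof -
  have "tree_proj D (tree_section g v) \<in> P" for v
  proof -
    obtain h where h: "h \<in> G" "tree_proj (length v + D) h = tree_proj (length v + D) g"
      using approx by blast
    then show ?thesis
      using tree_proj_section_cong[OF G_in_Aut_T[OF h(1)] g h(2)] G_pattern[OF h(1), of v] by simp
  qed
  then show ?thesis using g by (simp add: finite_type_group_def)
qed

text \<open>At the root the pattern is trivial, as \<open>s\<close> fixes level \<open>D\<close>. At
  any other vertex the section is a section of \<open>s\<close> or the identity.\<close>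

lemma at_letter_in_G:
  assumes s: "s \<in> G" "s \<in> level_stab D"
  shows "at_letter x s \<in> G"
proof -
  note A = at_letter_in_Aut_T[OF G_in_Aut_T[OF s(1)], of x]
  have "tree_proj D (tree_section (at_letter x s) v) \<in> P" for v
  proof (cases v)
    case Nil
    have "at_letter x s \<in> level_stab D"
      using at_letter_level_stab[OF s(2), of x] level_stab_antimono[of D "Suc D"] by auto
    then show ?thesis using Nil id_proj by (simp add: tree_section_Nil level_stab_iff)
  next
    case (Cons y w)
    have "tree_section (at_letter x s) v = tree_section (if y = x then s else id) w"
      using tree_section_append[OF A, of "[y]" w] Cons by (simp add: section_at_letter)
    then show ?thesis using G_pattern[OF s(1)] id_proj by (simp add: tree_section_id)
  qed
  then show ?thesis using A by (simp add: finite_type_group_def)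
qed

end

section \<open>Products of a homomorphism over the first-level sections\<close>

definition section_prod ::
  "('q, 'r) monoid_scheme \<Rightarrow> (('x list \<Rightarrow> 'x list) \<Rightarrow> 'q) \<Rightarrow> ('x list \<Rightarrow> 'x list) \<Rightarrow> 'q" where
  "section_prod Q \<phi> g = finprod Q (\<lambda>x. \<phi> (tree_section g [x])) UNIV"

context pattern_group
begin

text \<open>The sections of \<open>g\<close> in the cocycle rule are taken at the letters permuted
  by \<open>h\<close>. As \<open>Q\<close> is commutative, the product splits into two, and
  reindexing along the permutation \<open>root_perm h\<close> undoes the twist in the first.\<close>

lemma section_prod_hom:
  assumes Q: "comm_group Q" and \<phi>: "\<phi> \<in> hom \<Gamma> Q"
  shows "section_prod Q \<phi> \<in> hom \<Gamma> Q"
proof (rule homI)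
  interpret Q: comm_group Q by (rule Q)
  have cl: "\<phi> g \<in> carrier Q" if "g \<in> G" for g using \<phi> that by (auto simp: hom_def)
  fix g assume "g \<in> carrier \<Gamma>"
  then have g: "g \<in> G" by simp
  show "section_prod Q \<phi> g \<in> carrier Q"
    unfolding section_prod_def using g by (auto intro!: Q.finprod_closed cl section_in_G)
  fix h assume "h \<in> carrier \<Gamma>"
  then have h: "h \<in> G" by simp
  have gA: "g \<in> carrier Aut_T" and hA: "h \<in> carrier Aut_T" using g h G_in_Aut_T by auto
  have "\<phi> (tree_section (g \<circ> h) [x]) =
      \<phi> (tree_section g [root_perm h x]) \<otimes>\<^bsub>Q\<^esub> \<phi> (tree_section h [x])" for x
  proof -
    have "tree_section (g \<circ> h) [x] = tree_section g [root_perm h x] \<otimes>\<^bsub>\<Gamma>\<^esub> tree_section h [x]"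
      using tree_section_comp[OF gA hA, of "[x]"] singleton_root_perm[OF hA, of x]
        section_in_Aut_T[OF gA] section_in_Aut_T[OF hA] by (simp add: mult_Aut_T)
    then show ?thesis
      using \<phi> section_in_G[OF g] section_in_G[OF h] by (simp add: hom_def)
  qed
  then have "section_prod Q \<phi> (g \<circ> h) =
      finprod Q (\<lambda>x. \<phi> (tree_section g [root_perm h x])) UNIV \<otimes>\<^bsub>Q\<^esub> section_prod Q \<phi> h"
    unfolding section_prod_def using g h
    by (simp add: Q.finprod_multf Pi_iff cl section_in_G)
  also have "finprod Q (\<lambda>x. \<phi> (tree_section g [root_perm h x])) UNIV = section_prod Q \<phi> g"
    unfolding section_prod_def
    using Q.finprod_reindex[of "\<lambda>y. \<phi> (tree_section g [y])" "root_perm h" UNIV]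
      bij_root_perm[OF hA] cl section_in_G[OF g] by (simp add: bij_def Pi_iff)
  finally show "section_prod Q \<phi> (g \<otimes>\<^bsub>\<Gamma>\<^esub> h) = section_prod Q \<phi> g \<otimes>\<^bsub>Q\<^esub> section_prod Q \<phi> h"
    using gA hA by (simp add: mult_Aut_T comp_def)
qed

text \<open>All first-level sections except the one at \<open>x\<close> are the identity, so one
  factor survives. Nontriviality thus moves one level down with each application of
  \<open>section_prod\<close>.\<close>

lemma section_prod_at_letter:
  assumes Q: "comm_group Q" and \<phi>: "\<phi> \<in> hom \<Gamma> Q" and s: "s \<in> G"
  shows "section_prod Q \<phi> (at_letter x s) = \<phi> s"
proof -
  interpret Q: comm_group Q by (rule Q)
  have "\<phi> \<one>\<^bsub>\<Gamma>\<^esub> = \<one>\<^bsub>Q\<^esub>" by (rule hom_one[OF \<phi> \<Gamma>.is_group Q.is_group])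
  then have "\<phi> id = \<one>\<^bsub>Q\<^esub>" by (simp add: one_Aut_T)
  moreover have "\<phi> s \<in> carrier Q" using \<phi> s by (auto simp: hom_def)
  ultimately have "section_prod Q \<phi> (at_letter x s) =
      finprod Q (\<lambda>y. if x = y then \<phi> s else \<one>\<^bsub>Q\<^esub>) UNIV"
    unfolding section_prod_def section_at_letter by (intro Q.finprod_cong') auto
  then show ?thesis
    using Q.finprod_singleton[of x UNIV "\<lambda>_. \<phi> s"] \<open>\<phi> s \<in> carrier Q\<close> by simp
qed

lemma section_prod_trivial:
  assumes Q: "comm_group Q" and \<phi>: "\<And>g. g \<in> G \<Longrightarrow> g \<in> level_stab n \<Longrightarrow> \<phi> g = \<one>\<^bsub>Q\<^esub>"
    and g: "g \<in> G" "g \<in> level_stab (Suc n)"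
  shows "section_prod Q \<phi> g = \<one>\<^bsub>Q\<^esub>"
proof -
  interpret Q: comm_group Q by (rule Q)
  show ?thesis
    unfolding section_prod_def using \<phi>[OF section_in_G[OF g(1)] section_level_stab[OF g(2)]]
    by (simp add: Q.finprod_one_eqI)
qed

lemma dense_generate:
  assumes "topologically_fin_gen \<Gamma> (subtopology Aut_T_topology G)"
  obtains S where "finite S" "S \<subseteq> G"
    "\<And>g n. g \<in> G \<Longrightarrow> \<exists>h\<in>generate \<Gamma> S. tree_proj n h = tree_proj n g"
proof -
  obtain S where S: "finite S" "S \<subseteq> G"
    and cl: "subtopology Aut_T_topology G closure_of generate \<Gamma> S = G"
    using assms by (auto simp: topologically_fin_gen_def)
  have sub: "generate \<Gamma> S \<subseteq> G" using \<Gamma>.generate_incl[of S] S by simp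
  then have "G \<inter> (Aut_T_topology closure_of generate \<Gamma> S) = G"
    using cl by (simp add: closure_of_subtopology Int_absorb1)
  then have "\<exists>h\<in>generate \<Gamma> S. tree_proj n h = tree_proj n g" if "g \<in> G" for g n
    using that sub G_in_Aut_T closure_of_Aut_T_iff[of "generate \<Gamma> S" g] by blast
  then show ?thesis using that S by blast
qed

text \<open>The hypothesis \<open>triv\<close> is the continuity of \<open>\<phi>\<close>. If the
  conclusion failed, the iterates of \<open>section_prod\<close> would be nontrivial on ever deeper
  stabilizers. Homomorphisms that are trivial on some level stabilizer are determined by their
  values on a topological generating set \<open>S\<close>, and there are only finitely many
  functions from \<open>S\<close> to \<open>Q\<close>.\<close>

theorem hom_trivial_on_level_stab:
  assumes fg: "topologically_fin_gen \<Gamma> (subtopology Aut_T_topology G)"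
    and Q: "comm_group Q" "finite (carrier Q)"
    and \<phi>: "\<phi> \<in> hom \<Gamma> Q" and triv: "\<And>g. g \<in> G \<Longrightarrow> g \<in> level_stab n \<Longrightarrow> \<phi> g = \<one>\<^bsub>Q\<^esub>"
    and s: "s \<in> G" "s \<in> level_stab D"
  shows "\<phi> s = \<one>\<^bsub>Q\<^esub>"
proof (rule ccontr)
  interpret Q: comm_group Q by (rule Q(1))
  assume ne: "\<phi> s \<noteq> \<one>\<^bsub>Q\<^esub>"
  obtain S where S: "finite S" "S \<subseteq> G"
    and dense: "\<And>g n. g \<in> G \<Longrightarrow> \<exists>h\<in>generate \<Gamma> S. tree_proj n h = tree_proj n g"
    using dense_generate[OF fg] by blast
  define \<Phi> where "\<Phi> k = (section_prod Q ^^ k) \<phi>" for k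
  have hom: "\<Phi> k \<in> hom \<Gamma> Q" for k
    by (induction k) (simp_all add: \<Phi>_def \<phi> section_prod_hom[OF Q(1)])
  have lower: "\<Phi> k g = \<one>\<^bsub>Q\<^esub>" if "g \<in> G" "g \<in> level_stab (n + k)" for k g
    using that
  proof (induction k arbitrary: g)
    case (Suc k)
    show ?case
      using section_prod_trivial[OF Q(1), where n = "n + k" and \<phi> = "\<Phi> k"] Suc by (simp add: \<Phi>_def)
  qed (simp add: \<Phi>_def triv)
  have upper: "\<exists>t\<in>G. t \<in> level_stab (D + k) \<and> \<Phi> k t \<noteq> \<one>\<^bsub>Q\<^esub>" for k
  proof (induction k)
    case (Suc k)
    then obtain t where t: "t \<in> G" "t \<in> level_stab (D + k)" "\<Phi> k t \<noteq> \<one>\<^bsub>Q\<^esub>" by blast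
    \<comment> \<open>Any letter serves here; \<open>undefined\<close> is an arbitrary one.\<close>
    let ?t = "at_letter undefined t"
    have "t \<in> level_stab D" using t(2) level_stab_antimono[of D "D + k"] by auto
    then have "?t \<in> G" by (rule at_letter_in_G[OF t(1)])
    moreover have "?t \<in> level_stab (D + Suc k)" using at_letter_level_stab[OF t(2)] by simp
    moreover have "\<Phi> (Suc k) ?t = \<Phi> k t"
      using section_prod_at_letter[OF Q(1) hom t(1), of k] by (simp add: \<Phi>_def)
    ultimately show ?case using t(3) by metis
  qed (use s ne in \<open>auto simp: \<Phi>_def\<close>)
  txt \<open>
    The iterate \<open>\<Phi> k\<close> is trivial on level stabilizer \<open>n + k\<close> but not on \<open>D + k\<close>, so taking every
    \<open>n\<close>-th iterate makes them pairwise distinct.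
  \<close>
  define \<psi> where "\<psi> k = \<Phi> (n * k)" for k
  have distinct: "restrict (\<psi> k) S \<noteq> restrict (\<psi> l) S" if kl: "k < l" for k l
  proof
    assume eq: "restrict (\<psi> k) S = restrict (\<psi> l) S"
    have gen: "\<psi> k g = \<psi> l g" if "g \<in> generate \<Gamma> S" for g
    proof -
      interpret k: group_hom \<Gamma> Q "\<psi> k" using hom by unfold_locales (simp add: \<psi>_def)
      interpret l: group_hom \<Gamma> Q "\<psi> l" using hom by unfold_locales (simp add: \<psi>_def)
      have on_S: "\<psi> k x = \<psi> l x" if "x \<in> S" for x using fun_cong[OF eq, of x] that by simp
      have SG: "x \<in> carrier \<Gamma>" if "x \<in> S" for x using that S by auto
      have in_G: "x \<in> carrier \<Gamma>" if "x \<in> generate \<Gamma> S" for x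
        using \<Gamma>.generate_in_carrier[OF _ that] S by auto
      show ?thesis
        using that
      proof induction
        case one
        then show ?case by (simp only: k.hom_one l.hom_one)
      next
        case (incl x)
        then show ?case by (rule on_S)
      next
        case (inv x)
        then show ?case by (simp only: k.hom_inv[OF SG] l.hom_inv[OF SG] on_S)
      next
        case (eng x y)
        then show ?case by (simp only: k.hom_mult[OF in_G in_G] l.hom_mult[OF in_G in_G])
      qed
    qed
    have le: "n + n * k \<le> D + n * l"
      using kl by (metis Suc_leI mult_Suc_right mult_le_mono2 trans_le_add2)
    obtain t where t: "t \<in> G" "t \<in> level_stab (D + n * l)" "\<psi> l t \<noteq> \<one>\<^bsub>Q\<^esub>"
      using upper[of "n * l"] by (auto simp: \<psi>_def)
    \<comment> \<open>This level is deep enough for \<open>h\<close> to lie in the stabilizer of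
      level \<open>D + n * l\<close>, like \<open>t\<close>, and for \<open>t\<close> to differ from
      \<open>h\<close> only by an element \<open>r\<close> of the stabilizer of level
      \<open>n + n * l\<close>, which \<open>\<psi> l\<close> kills. By \<open>le\<close>,
      \<open>\<psi> k\<close> kills \<open>h\<close>, hence so does \<open>\<psi> l\<close>, and
      then \<open>\<psi> l t\<close> is trivial.\<close>
    let ?N = "max (n + n * l) (D + n * l)"
    obtain h where h: "h \<in> generate \<Gamma> S" "tree_proj ?N h = tree_proj ?N t"
      using dense[OF t(1)] by blast
    have hG: "h \<in> G" using \<Gamma>.generate_in_carrier[OF _ h(1)] S by auto
    have "h \<in> level_stab (D + n * l)"
      using tree_proj_mono[OF h(2), of "D + n * l"] t(2) G_in_Aut_T[OF hG] by (simp add: level_stab_iff)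
    then have "h \<in> level_stab (n + n * k)" using level_stab_antimono[OF le] by blast
    then have "\<psi> k h = \<one>\<^bsub>Q\<^esub>" using lower[OF hG] by (simp add: \<psi>_def)
    then have hl: "\<psi> l h = \<one>\<^bsub>Q\<^esub>" using gen[OF h(1)] by simp
    have "t \<in> h <#\<^bsub>Aut_T\<^esub> level_stab (n + n * l)"
      using tree_proj_mono[OF h(2), of "n + n * l"] G_in_Aut_T[OF hG] G_in_Aut_T[OF t(1)]
      by (simp add: l_coset_level_stab)
    then obtain r where r: "r \<in> level_stab (n + n * l)" "t = h \<otimes>\<^bsub>Aut_T\<^esub> r"
      by (auto simp: l_coset_def)
    then have "r = inv\<^bsub>Aut_T\<^esub> h \<otimes>\<^bsub>Aut_T\<^esub> t"
      using G_in_Aut_T[OF hG] by (simp add: level_stab_def Aut_T.m_assoc[symmetric])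
    then have rG: "r \<in> G"
      using subgroup.m_closed[OF subgroup_G subgroup.m_inv_closed[OF subgroup_G hG] t(1)] by simp
    have "\<psi> l t = \<psi> l h \<otimes>\<^bsub>Q\<^esub> \<psi> l r"
      using hom[of "n * l"] r(2) hG rG by (simp add: hom_def \<psi>_def)
    also have "\<dots> = \<one>\<^bsub>Q\<^esub>" using hl lower[OF rG r(1)] by (simp add: \<psi>_def)
    finally show False using t(3) by simp
  qed
  have inj: "inj (\<lambda>k. restrict (\<psi> k) S)"
    using distinct by (intro injI) (metis nat_neq_iff)
  have cl: "\<psi> k x \<in> carrier Q" if "x \<in> S" for k x
    unfolding \<psi>_def by (rule hom_in_carrier[OF hom]) (use S(2) that in auto)
  have "range (\<lambda>k. restrict (\<psi> k) S) \<subseteq> (\<Pi>\<^sub>E x\<in>S. carrier Q)"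
    by (intro image_subsetI) (simp add: restrict_PiE_iff cl)
  moreover have "finite (\<Pi>\<^sub>E x\<in>S. carrier Q)" by (rule finite_PiE) (use S(1) Q(2) in auto)
  ultimately have "finite (range (\<lambda>k. restrict (\<psi> k) S))" by (rule finite_subset)
  then show False using range_inj_infinite[OF inj] by simp
qed

end

section \<open>Level quotients\<close>

lemma prime_power_if_unique_prime_divisor:
  fixes n p :: nat
  assumes p: "prime p" and n: "n > 0" and uniq: "\<And>q. prime q \<Longrightarrow> q dvd n \<Longrightarrow> q = p"
  shows "\<exists>k. n = p ^ k"
proof -
  have "n \<noteq> 0" "\<not> is_unit p" using n p by auto
  from multiplicity_decompose'[OF this]
  obtain r where r: "n = p ^ multiplicity p n * r" "\<not> p dvd r" by blast
  have "r = 1"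
  proof (rule ccontr)
    assume "r \<noteq> 1"
    then obtain q where q: "prime q" "q dvd r" using prime_factor_nat by blast
    then have "q = p" using uniq r(1) by (metis dvd_mult)
    then show False using q r(2) by simp
  qed
  then show ?thesis using r(1) by auto
qed

text \<open>The case of exponent 1 in \<open>sylow_thm\<close> is Cauchy's theorem: a prime
  \<open>q\<close> dividing the order yields an element of order \<open>q\<close>. Then
  \<open>q\<close> divides \<open>p ^ N\<close>, so \<open>q = p\<close>.\<close>

lemma (in group) p_group_if_exponent:
  assumes p: "prime (p::nat)" and fin: "finite (carrier G)"
    and exp: "\<And>x. x \<in> carrier G \<Longrightarrow> x [^] (p ^ N) = \<one>"
  shows "\<exists>k. order G = p ^ k"
proof (rule prime_power_if_unique_prime_divisor[OF p])
  show "order G > 0" using fin by (simp add: order_gt_0_iff_finite)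
  fix q :: nat assume q: "prime q" "q dvd order G"
  then obtain m where m: "order G = q ^ 1 * m" by auto
  obtain H where H: "subgroup H G" "card H = q ^ 1"
    using sylow_thm[OF q(1) is_group m fin] by blast
  have "card H > 1" using H(2) prime_gt_1_nat[OF q(1)] by simp
  then have "H \<noteq> {\<one>}" by auto
  then obtain x where x: "x \<in> H" "x \<noteq> \<one>"
    using subgroup.one_closed[OF H(1)] by blast
  have xG: "x \<in> carrier G" using x(1) subgroup.subset[OF H(1)] by blast
  have "ord x dvd p ^ N" using exp[OF xG] pow_eq_id[OF xG] by blast
  moreover have "ord x dvd q"
  proof -
    interpret H: group "G\<lparr>carrier := H\<rparr>" by (rule subgroup_imp_group[OF H(1)])
    have "x [^]\<^bsub>G\<lparr>carrier := H\<rparr>\<^esub> order (G\<lparr>carrier := H\<rparr>) = \<one>\<^bsub>G\<lparr>carrier := H\<rparr>\<^esub>"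
      using x(1) by (intro H.pow_order_eq_1) simp
    then have "x [^] q = \<one>" using H(2) by (simp add: order_def flip: nat_pow_consistent)
    then show ?thesis using pow_eq_id[OF xG] by blast
  qed
  moreover have "ord x \<noteq> 1" using x(2) xG ord_eq_1 by blast
  ultimately have "ord x = q" "q dvd p ^ N" using q(1) by (metis prime_nat_iff)+
  then show "q = p" using p q(1) by (metis prime_dvd_power primes_dvd_imp_eq)
qed

text \<open>At a fixed vertex the twist in the cocycle rule disappears, so taking sections there
  commutes with powers.\<close>

lemma section_nat_pow:
  assumes h: "h \<in> carrier Aut_T" and fixed: "h v = v"
  shows "(h [^]\<^bsub>Aut_T\<^esub> (i::nat)) v = v \<and>
    tree_section (h [^]\<^bsub>Aut_T\<^esub> i) v = tree_section h v [^]\<^bsub>Aut_T\<^esub> i"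
proof (induction i)
  case 0
  then show ?case by (simp add: one_Aut_T tree_section_def fun_eq_iff)
next
  case (Suc i)
  have "h [^]\<^bsub>Aut_T\<^esub> Suc i = (h [^]\<^bsub>Aut_T\<^esub> i) \<circ> h"
    using mult_Aut_T[OF Aut_T.nat_pow_closed[OF h] h] by simp
  moreover have "tree_section h v [^]\<^bsub>Aut_T\<^esub> Suc i = (tree_section h v [^]\<^bsub>Aut_T\<^esub> i) \<circ> tree_section h v"
    using mult_Aut_T[OF Aut_T.nat_pow_closed[OF section_in_Aut_T[OF h]] section_in_Aut_T[OF h]] by simp
  ultimately show ?case
    using Suc fixed tree_section_comp[OF Aut_T.nat_pow_closed[OF h] h, of i v]
    by (simp add: comp_def)
qed

context pattern_group
begin

lemma nat_pow_in_G: "g \<in> G \<Longrightarrow> g [^]\<^bsub>Aut_T\<^esub> (i::nat) \<in> G"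
  using \<Gamma>.nat_pow_closed[of g i] by (simp flip: Aut_T.nat_pow_consistent)

lemma pow_order_level_stab:
  assumes g: "g \<in> G"
  shows "g [^]\<^bsub>Aut_T\<^esub> card P \<in> level_stab D"
proof -
  interpret P: group "(Aut_T_trunc D)\<lparr>carrier := P\<rparr>"
    by (rule Aut_trunc.subgroup_imp_group[OF pattern_subgroup])
  have "tree_proj D g [^]\<^bsub>Aut_T_trunc D\<^esub> card P = \<one>\<^bsub>Aut_T_trunc D\<^esub>"
    using P.pow_order_eq_1[of "tree_proj D g"] G_proj[OF g]
    by (simp add: order_def flip: Aut_trunc.nat_pow_consistent)
  then show ?thesis
    using tree_proj.hom_nat_pow[OF G_in_Aut_T[OF g], of D "card P"] Aut_T.nat_pow_closed[OF G_in_Aut_T[OF g]]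
    by (simp add: level_stab_iff tree_proj_id)
qed

text \<open>By Lagrange in \<open>P\<close>, the power \<open>card P\<close> fixes level
  \<open>D\<close>, hence level 1 as \<open>D > 0\<close>. Its sections at letters lie in
  \<open>G\<close> again, and the induction hypothesis applied to them gains one level.\<close>

lemma pow_level_stab:
  assumes D: "D > 0" and g: "g \<in> G"
  shows "g [^]\<^bsub>Aut_T\<^esub> (card P ^ j) \<in> level_stab j"
  using g
proof (induction j arbitrary: g)
  case 0
  then show ?case using Aut_T.nat_pow_closed[OF G_in_Aut_T[OF 0], of 1]
    by (simp add: level_stab_def carrier_Aut_T)
next
  case (Suc j)
  let ?h = "g [^]\<^bsub>Aut_T\<^esub> card P"
  let ?k = "?h [^]\<^bsub>Aut_T\<^esub> (card P ^ j)"
  have hG: "?h \<in> G" by (rule nat_pow_in_G[OF Suc.prems])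
  note hA = G_in_Aut_T[OF hG]
  have kA: "?k \<in> carrier Aut_T" by (rule Aut_T.nat_pow_closed[OF hA])
  have "?h \<in> level_stab 1"
    using pow_order_level_stab[OF Suc.prems] level_stab_antimono[of 1 D] D by auto
  then have fixed: "?h [x] = [x]" for x by (simp add: level_stab_def)
  have "?k v = v" if v: "length v = Suc j" for v
  proof -
    obtain x w where xw: "v = [x] @ w" "length w = j" using v by (auto simp: length_Suc_conv)
    have "tree_section ?h [x] [^]\<^bsub>Aut_T\<^esub> (card P ^ j) \<in> level_stab j"
      by (rule Suc.IH[OF section_in_G[OF hG]])
    then have "tree_section ?k [x] w = w"
      using section_nat_pow[OF hA fixed] xw(2) by (simp add: level_stab_def)
    then show ?thesis
      using section_eq[OF kA, of "[x]" w] section_nat_pow[OF hA fixed] xw(1) by simp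
  qed
  then have "?k \<in> level_stab (Suc j)" using kA by (simp add: level_stab_def)
  then show ?case using Aut_T.nat_pow_pow[OF G_in_Aut_T[OF Suc.prems]] by simp
qed

abbreviation level_group :: "nat \<Rightarrow> ('x list \<Rightarrow> 'x list) monoid" where
  "level_group n \<equiv> (Aut_T_trunc n)\<lparr>carrier := tree_proj n ` G\<rparr>"

lemma subgroup_proj_G: "subgroup (tree_proj n ` G) (Aut_T_trunc n)"
  by (rule tree_proj.subgroup_img_is_subgroup[OF subgroup_G])

text \<open>On level \<open>n\<close> the exponent divides \<open>card P ^ n\<close>, by
  \<open>pow_level_stab\<close>; this is a power of \<open>p\<close>.\<close>

lemma p_group_level_group:
  assumes D: "D > 0" and p: "prime p" and P: "card P = p ^ k"
  shows "\<exists>l. order (level_group n) = p ^ l"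
proof (rule group.p_group_if_exponent[OF _ p])
  show "group (level_group n)" by (rule Aut_trunc.subgroup_imp_group[OF subgroup_proj_G])
  show "finite (carrier (level_group n))"
    using finite_subset[OF subgroup.subset[OF subgroup_proj_G] finite_Aut_trunc] by simp
  fix a assume "a \<in> carrier (level_group n)"
  then obtain g where g: "g \<in> G" "a = tree_proj n g" by auto
  have "tree_proj n (g [^]\<^bsub>Aut_T\<^esub> (card P ^ n)) = \<one>\<^bsub>Aut_T_trunc n\<^esub>"
    using pow_level_stab[OF D g(1), of n] by (simp add: level_stab_iff tree_proj_id)
  then show "a [^]\<^bsub>level_group n\<^esub> (p ^ (k * n)) = \<one>\<^bsub>level_group n\<^esub>"
    using tree_proj.hom_nat_pow[OF G_in_Aut_T[OF g(1)], of n "card P ^ n"] P g(2)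
    by (simp add: power_mult flip: Aut_trunc.nat_pow_consistent)
qed

theorem level_images_eq:
  assumes fg: "topologically_fin_gen \<Gamma> (subtopology Aut_T_topology G)"
    and D: "D > 0" and p: "prime p" and P: "card P = p ^ k"
    and H: "subgroup H Aut_T" "H \<subseteq> G" "tree_proj D ` G \<subseteq> tree_proj D ` H"
  shows "tree_proj n ` H = tree_proj n ` G"
proof (rule ccontr)
  assume ne: "tree_proj n ` H \<noteq> tree_proj n ` G"
  interpret L: group "level_group n" by (rule Aut_trunc.subgroup_imp_group[OF subgroup_proj_G])
  obtain l where l: "order (level_group n) = p ^ l" using p_group_level_group[OF D p P] by blast
  have "subgroup (tree_proj n ` H) (Aut_T_trunc n)"
    by (rule tree_proj.subgroup_img_is_subgroup[OF H(1)])
  then have "subgroup (tree_proj n ` H) (level_group n)"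
    using Aut_trunc.subgroup_incl[OF _ subgroup_proj_G] H(2) by blast
  from L.p_group_abelian_quotient[OF p l this] ne
  obtain N where N: "N \<lhd> level_group n" "tree_proj n ` H \<subseteq> N" "N \<noteq> tree_proj n ` G"
    and comm: "comm_group (level_group n Mod N)" by auto
  interpret N: normal N "level_group n" by (rule N(1))
  \<comment> \<open>Projection to level \<open>n\<close> followed by the quotient map: a
    homomorphism to a finite abelian group that is trivial on \<open>level_stab n\<close>, as
    \<open>hom_trivial_on_level_stab\<close> requires.\<close>
  let ?\<phi> = "\<lambda>g. N #>\<^bsub>level_group n\<^esub> tree_proj n g"
  have "tree_proj n \<in> hom \<Gamma> (level_group n)"
    using G_in_Aut_T by (intro homI) auto
  then have hom: "?\<phi> \<in> hom \<Gamma> (level_group n Mod N)"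
    using hom_compose[OF _ N.r_coset_hom_Mod] by (simp add: comp_def)
  have "finite (carrier (level_group n))"
    using finite_subset[OF subgroup.subset[OF subgroup_proj_G] finite_Aut_trunc] by simp
  then have finQ: "finite (carrier (level_group n Mod N))"
    using L.rcosets_subset_PowG[OF N.subgroup_axioms]
    by (metis (no_types, lifting) FactGroup_def finite_Pow_iff finite_subset partial_object.select_convs(1))
  have coset_N: "N #>\<^bsub>level_group n\<^esub> a = N" if "a \<in> N" for a
    using that L.coset_join2 N.subset N.subgroup_axioms by blast
  have "?\<phi> g = \<one>\<^bsub>level_group n Mod N\<^esub>" if "g \<in> level_stab n" for g
    using coset_N[OF N.one_closed] that by (simp add: level_stab_iff tree_proj_id FactGroup_def)
  from hom_trivial_on_level_stab[OF fg comm finQ hom this]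
  have triv: "?\<phi> s = N" if "s \<in> G" "s \<in> level_stab D" for s
    using that by (simp add: FactGroup_def)
  have "tree_proj n g \<in> N" if g: "g \<in> G" for g
  proof -
    \<comment> \<open>Write \<open>g = h s\<close> with \<open>h\<close> in \<open>H\<close> and
      \<open>s\<close> in the stabilizer of level \<open>D\<close>. The first factor projects into
      \<open>N\<close> by the choice of \<open>N\<close>, the second by \<open>triv\<close>, so
      \<open>N\<close> would be everything.\<close>
    obtain h where h: "h \<in> H" "tree_proj D h = tree_proj D g" using g H(3) by fastforce
    then have hG: "h \<in> G" using H(2) by blast
    have "g \<in> h <#\<^bsub>Aut_T\<^esub> level_stab D"
      using h(2) G_in_Aut_T[OF g] G_in_Aut_T[OF hG] by (simp add: l_coset_level_stab)
    then obtain s where s: "s \<in> level_stab D" "g = h \<otimes>\<^bsub>Aut_T\<^esub> s" by (auto simp: l_coset_def)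
    then have "s = inv\<^bsub>Aut_T\<^esub> h \<otimes>\<^bsub>Aut_T\<^esub> g"
      using G_in_Aut_T[OF hG] by (simp add: level_stab_def Aut_T.m_assoc[symmetric])
    then have sG: "s \<in> G"
      using subgroup.m_closed[OF subgroup_G subgroup.m_inv_closed[OF subgroup_G hG] g] by simp
    have "tree_proj n s \<in> N"
      using L.coset_join1[OF triv[OF sG s(1)] _ N.subgroup_axioms] sG by simp
    moreover have "tree_proj n h \<in> N" using h(1) N(2) by blast
    ultimately have "tree_proj n h \<otimes>\<^bsub>Aut_T_trunc n\<^esub> tree_proj n s \<in> N"
      using N.m_closed by simp
    then show ?thesis using s(2) G_in_Aut_T[OF hG] G_in_Aut_T[OF sG] by simp
  qed
  then show False using N(3) N.subset by auto
qed

text \<open>In depth 0 all patterns are trivial and every automorphism fixes level \<open>D\<close>.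
  Topological finite generation would then make every continuous homomorphism to a finite abelian
  group trivial, but the sign of the first-level permutation takes the value -1 on a
  transposition.\<close>

lemma not_fin_gen_depth_0:
  assumes D: "D = 0" and card: "CARD('x) \<ge> 2"
  shows "\<not> topologically_fin_gen \<Gamma> (subtopology Aut_T_topology G)"
proof
  assume fg: "topologically_fin_gen \<Gamma> (subtopology Aut_T_topology G)"
  have root: "tree_proj 0 g = tree_proj 0 id" if "g \<in> carrier Aut_T" for g :: "'x list \<Rightarrow> 'x list"
    using that by (auto simp: tree_proj_def trunc_tree_def carrier_Aut_T)
  then have GA: "G = carrier Aut_T"
    using id_proj section_in_Aut_T D by (fastforce simp: finite_type_group_def)
  have perm: "permutation (root_perm g)" if "g \<in> carrier Aut_T" for g :: "'x list \<Rightarrow> 'x list"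
    using bij_root_perm[OF that] by (simp add: permutation)
  have comm: "comm_group sign_img"
    using sign_img_is_group by (rule group.group_comm_groupI) (auto simp: sign_img_def)
  let ?\<phi> = "\<lambda>g :: 'x list \<Rightarrow> 'x list. sign (root_perm g)"
  have hom: "?\<phi> \<in> hom \<Gamma> sign_img"
  proof (rule homI)
    fix g h :: "'x list \<Rightarrow> 'x list"
    show "?\<phi> g \<in> carrier sign_img" by (simp add: sign_img_def sign_def)
    assume "g \<in> carrier \<Gamma>" "h \<in> carrier \<Gamma>"
    then show "?\<phi> (g \<otimes>\<^bsub>\<Gamma>\<^esub> h) = ?\<phi> g \<otimes>\<^bsub>sign_img\<^esub> ?\<phi> h"
      by (simp add: GA mult_Aut_T root_perm_comp sign_compose perm sign_img_def)
  qed
  have triv: "?\<phi> g = \<one>\<^bsub>sign_img\<^esub>" if "g \<in> level_stab 1" for g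
  proof -
    have "root_perm g = id" using that by (auto simp: root_perm_def level_stab_def)
    then show ?thesis by (simp add: sign_img_def)
  qed
  obtain a b :: 'x where ab: "a \<noteq> b"
    using card by (metis card_le_Suc0_iff_eq finite_class.finite_UNIV UNIV_I not_less_eq_eq numeral_2_eq_2)
  \<comment> \<open>State \<open>True\<close> swaps \<open>a\<close> and \<open>b\<close> in the
    first letter and then passes to \<open>False\<close>, which acts as the identity. This yields a
    transposition at the root whose membership in Aut(T) follows from
    \<open>state_aut_in_Aut_T\<close>.\<close>
  define B :: "(bool, 'x) automaton" where
    "B = \<lparr>states = UNIV, trans = (\<lambda>(q, x). (if q then Transposition.transpose a b x else x, False))\<rparr>"
  have bij_if: "bij (\<lambda>x. if q then Transposition.transpose a b x else x)" for q
    by (cases q) (simp_all add: bij_id[unfolded id_def])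
  have B: "state_aut B True \<in> carrier Aut_T"
    by (rule state_aut_in_Aut_T)
      (auto simp: B_def is_automaton_def invertible_automaton_def bij_if)
  have "?\<phi> (state_aut B True) = \<one>\<^bsub>sign_img\<^esub>"
    using hom_trivial_on_level_stab[OF fg comm _ hom triv, of 1 "state_aut B True"] B GA D
    by (simp add: sign_img_def level_stab_def carrier_Aut_T)
  moreover have "root_perm (state_aut B True) = Transposition.transpose a b"
    by (auto simp: root_perm_def B_def)
  ultimately show False using ab by (simp add: sign_img_def sign_swap_id)
qed

end

section \<open>Automaton groups and the closure theorem\<close>

lemma section_state_aut:
  assumes "is_automaton A" "q \<in> states A"
  shows "\<exists>q'\<in>states A. tree_section (state_aut A q) v = state_aut A q'"
  using assms(2)
proof (induction v arbitrary: q)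
  case Nil
  then show ?case by (auto simp: tree_section_def)
next
  case (Cons x v)
  have "snd (trans A (q, x)) \<in> states A" using assms(1) Cons.prems by (simp add: is_automaton_def)
  from Cons.IH[OF this] show ?case by (simp add: tree_section_def)
qed

theorem theorem7:
  fixes A :: "('q, 'x::finite) automaton"
    and p D :: nat
    and P :: "('x list \<Rightarrow> 'x list) set"
  assumes "CARD('x) \<ge> 2"
    and "is_automaton A"
    and "finite_automaton A"
    and "invertible_automaton A"
    and "prime p"
    and "minimal_pattern_subgroup D P"
    and "\<exists>k. order ((Aut_T_trunc D)\<lparr>carrier := P\<rparr>) = p ^ k"
    and "topologically_fin_gen (Aut_T\<lparr>carrier := finite_type_group D P\<rparr>)
           (subtopology Aut_T_topology (finite_type_group D P))"
    and "tree_proj D ` automaton_group A = P"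
  shows "finite_type_group D P = Aut_T_topology closure_of automaton_group A"
proof -
  interpret pattern_group D P
    using assms(6) by (intro pattern_group.intro) (simp add: minimal_pattern_subgroup_def)
  have D: "D > 0" using not_fin_gen_depth_0 assms(1,8) by blast
  obtain k where k: "card P = p ^ k" using assms(7) by (auto simp: order_def)
  let ?H = "automaton_group A"
  have gens: "state_aut A ` states A \<subseteq> carrier Aut_T"
    using state_aut_in_Aut_T[OF assms(2,4)] by blast
  have H: "subgroup ?H Aut_T"
    unfolding automaton_group_def by (rule Aut_T.generate_is_subgroup[OF gens])
  \<comment> \<open>Every section of a state is again a state, so it lies in \<open>?H\<close>,
    whose projection to depth \<open>D\<close> is \<open>P\<close>. Checking the generators suffices
    because \<open>G\<close> is a subgroup.\<close>
  have "state_aut A q \<in> G" if q: "q \<in> states A" for q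
  proof -
    have "tree_proj D (tree_section (state_aut A q) v) \<in> P" for v
    proof -
      obtain q' where "q' \<in> states A" "tree_section (state_aut A q) v = state_aut A q'"
        using section_state_aut[OF assms(2) q] by blast
      then have "tree_section (state_aut A q) v \<in> ?H"
        unfolding automaton_group_def by (simp add: generate.incl)
      then show ?thesis using assms(9) by blast
    qed
    then show ?thesis
      using gens q by (auto simp: finite_type_group_def)
  qed
  then have HG: "?H \<subseteq> G"
    unfolding automaton_group_def by (intro Aut_T.generate_subgroup_incl[OF _ subgroup_G]) blast
  have "tree_proj D ` G \<subseteq> tree_proj D ` ?H" using G_proj assms(9) by blast
  note level = level_images_eq[OF assms(8) D assms(5) k H HG this]
  \<comment> \<open>Forward, \<open>?H\<close> and \<open>G\<close> have the same image on every
    level; backward, \<open>G\<close> is closed by \<open>G_closed\<close>.\<close>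
  have "g \<in> G \<longleftrightarrow> g \<in> carrier Aut_T \<and> (\<forall>n. \<exists>h\<in>?H. tree_proj n h = tree_proj n g)" for g
  proof
    assume g: "g \<in> G"
    have "\<exists>h\<in>?H. tree_proj n h = tree_proj n g" for n
      using level[of n] g by (metis imageE imageI)
    then show "g \<in> carrier Aut_T \<and> (\<forall>n. \<exists>h\<in>?H. tree_proj n h = tree_proj n g)"
      using G_in_Aut_T[OF g] by blast
  next
    assume "g \<in> carrier Aut_T \<and> (\<forall>n. \<exists>h\<in>?H. tree_proj n h = tree_proj n g)"
    then show "g \<in> G" using G_closed[of g] HG by blast
  qed
  then show ?thesis
    using closure_of_Aut_T_iff[OF subgroup.subset[OF H]] by blast
qed

end
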